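(* Let $a,b>0$. For every $c>0$ we have $$e_c(a,b)(t)=\frac{(2\pi)^{(c-1)/2}}{a\sqrt{c}\,\Gamma(b)^c}\,\frac{\exp(-ct^{1/(ac)})}{t^{1-(b-1/2+1/(2c))/a}}\left[1+\mathcal{O}\left(t^{-1/(ac)}\right)\right],\quad t\to\infty.$$
   Context: For $a,b,c>0$, $$e_c(a,b)(t)=\frac{1}{2\pi}\int_{-\infty}^\infty t^{ix-1}[\Gamma(b-iax)/\Gamma(b)]^c\,dx,\quad t>0.$$ Here $[\Gamma(z)/\Gamma(b)]^c:=\exp(c\log\Gamma(z)-c\log\Gamma(b))$, where $\log\Gamma$ is the holomorphic branch on $\mathbb{C}\setminus(-\infty,0]$ of the logarithm of $\Gamma$ that is $0$ at $z=1$. The parameters $a,b,c$ are fixed in the asymptotic statement (the constant in $\mathcal{O}$ may depend on them). *)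

theory Defs
  imports "HOL-Analysis.Analysis" "HOL-Library.Landau_Symbols"
begin

text \<open>
  The library's complex log-Gamma function is the branch used here: it is holomorphic off the
  half-line \<open>(-\<infinity>, 0]\<close>, is a logarithm of Gamma there, and vanishes at 1.
\<close>

lemma ln_Gamma_branch:
  shows "(ln_Gamma :: complex \<Rightarrow> complex) holomorphic_on (UNIV - \<real>\<^sub>\<le>\<^sub>0)"
    and "\<And>z :: complex. z \<notin> \<real>\<^sub>\<le>\<^sub>0 \<Longrightarrow> exp (ln_Gamma z) = Gamma z"
    and "ln_Gamma (1 :: complex) = 0"
proof -
  show "(ln_Gamma :: complex \<Rightarrow> complex) holomorphic_on (UNIV - \<real>\<^sub>\<le>\<^sub>0)"
    by (rule holomorphic_ln_Gamma) auto
  show "exp (ln_Gamma z) = Gamma z" if "z \<notin> \<real>\<^sub>\<le>\<^sub>0" for z :: complex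
    using that nonpos_Ints_subset_nonpos_Reals by (auto simp: Gamma_complex_altdef)
  have "ln_Gamma (complex_of_real 1) = of_real (ln_Gamma 1)"
    by (rule ln_Gamma_complex_of_real) simp
  thus "ln_Gamma (1 :: complex) = 0"
    by (simp add: ln_Gamma_real_pos)
qed

definition Gamma_ratio_power :: "real \<Rightarrow> real \<Rightarrow> complex \<Rightarrow> complex" where
  "Gamma_ratio_power c b z =
     exp (of_real c * ln_Gamma z - of_real c * ln_Gamma (of_real b))"

text \<open>
  The Lebesgue integral over the real line, kept complex-valued; the integrand is used for
  \<open>a, b, c, t > 0\<close> only, where \<open>of_real t powr w = exp (w * ln t)\<close>.
\<close>

definition e_density :: "real \<Rightarrow> real \<Rightarrow> real \<Rightarrow> real \<Rightarrow> complex" where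
  "e_density c a b t =
     1 / (2 * of_real pi) *
     (LINT x|lborel. of_real t powr (\<i> * of_real x - 1) *
        Gamma_ratio_power c b (of_real b - \<i> * of_real a * of_real x))"

end

theory Submission
  imports Defs "HOL-Complex_Analysis.Complex_Analysis" "HOL-Real_Asymp.Real_Asymp"
begin

text \<open>
  With \<open>t = N\<^sup>a\<^sup>c\<close> and \<open>s = b - iax\<close>, the density is an elementary factor times the integral of
  \<open>N\<^sup>-\<^sup>c\<^sup>s \<Gamma>(s)\<^sup>c\<close> over the line \<open>Re s = b\<close>, which Cauchy's theorem moves to \<open>Re s = N\<close>. There Stirling's
  formula replaces \<open>\<Gamma>(s)\<^sup>c\<close> by a constant times \<open>c\<^sup>-\<^sup>c\<^sup>s \<Gamma>(cs + (1 - c)/2)\<close>, uniformly up to a factor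
  \<open>1 + O(1/N)\<close>. No saddle point analysis is needed, because the inverse Mellin transform of the
  replacement is an exponential, and the error is controlled by
  \<open>\<integral> |\<Gamma>(\<sigma> + iy)| dy = O(\<surd>\<sigma> \<Gamma>(\<sigma>))\<close>.
\<close>

section \<open>Decay of Gamma on vertical lines\<close>

text \<open>The logarithm of the integrand, c (ln Gamma(s) - s ln N), is stationary where psi(s) =
  ln N, that is near s = N; this dictates the new line.

  The shift (1 - c)/2 is forced: besides the common term c s Ln s, Stirling's formula gives -(c/2)
  Ln s for c ln Gamma(s) and (d - 1/2) Ln s for ln Gamma(cs + d), and these agree exactly when d =
  (1 - c)/2.

  The obstacle is that a relative error O(1/N) of the integrand survives integration only if the
  integral of the absolute value is at most a constant times the integral itself. The latter is
  explicit, of size exp(-cN) up to the common prefactor; the former is at most of order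
  (cN)^(-\<sigma>) sqrt \<sigma> Gamma(\<sigma>) with \<sigma> = cN + d, which is again O(exp(-cN)).
  Hence the care for the factor sqrt \<sigma>: a larger power of \<sigma> would destroy the error
  term. For the same reason the remainder in Stirling's formula is bounded by a multiple of 1 / Re
  z, uniformly in Im z.\<close>

lemma integrable_inverse_1_plus_square:
  "integrable lborel (\<lambda>y::real. 1 / (1 + y\<^sup>2))"
proof -
  have "set_integrable lborel (einterval (-\<infinity>) \<infinity>) (\<lambda>y::real. 1 / (1 + y\<^sup>2))"
  proof (rule interval_integral_FTC_nonneg(1)[where F = arctan and A = "-(pi/2)" and B = "pi/2"])
    show "DERIV arctan x :> 1 / (1 + x\<^sup>2)" for x :: real
      by (auto intro!: derivative_eq_intros simp: divide_inverse)
    show "isCont (\<lambda>y::real. 1 / (1 + y\<^sup>2)) x" for x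
      by (intro continuous_intros) (simp add: add_nonneg_eq_0_iff)
    show "((arctan \<circ> real_of_ereal) \<longlongrightarrow> - (pi / 2)) (at_right (- \<infinity>))"
      using tendsto_arctan_at_bot by (simp add: ereal_tendsto_simps)
    show "((arctan \<circ> real_of_ereal) \<longlongrightarrow> pi / 2) (at_left \<infinity>)"
      using tendsto_arctan_at_top by (simp add: ereal_tendsto_simps)
  qed auto
  thus ?thesis by (simp add: set_integrable_def einterval_eq)
qed

lemma Re_pos_not_nonpos_Ints: "Re z > 0 \<Longrightarrow> z \<notin> \<int>\<^sub>\<le>\<^sub>0"
  by (auto elim!: nonpos_Ints_cases)

text \<open>Holds term by term in Euler's limit n! n^z / (z (z + 1) ... (z + n)): the numerator has
  norm n! n^(Re z), and each factor of the denominator satisfies |z + i| \<ge> Re z + i.\<close>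

lemma norm_Gamma_le_Gamma_Re:
  fixes z :: complex
  assumes "Re z > 0"
  shows "norm (Gamma z) \<le> Gamma (Re z)"
proof (rule LIMSEQ_le)
  show "(\<lambda>n. norm (Gamma_series z n)) \<longlonglongrightarrow> norm (Gamma z)"
    by (intro tendsto_norm Gamma_series_LIMSEQ)
  show "Gamma_series (Re z) \<longlonglongrightarrow> Gamma (Re z)"
    by (rule Gamma_series_LIMSEQ)
  have "norm (Gamma_series z n) \<le> Gamma_series (Re z) n" for n
  proof -
    have "0 < pochhammer (Re z) (n + 1)"
      using assms by (intro pochhammer_pos)
    moreover have "pochhammer (Re z) (n + 1) \<le> norm (pochhammer z (n + 1))"
      unfolding pochhammer_prod prod_norm [symmetric]
    proof (intro prod_mono conjI)
      fix i
      show "0 \<le> Re z + real i" using assms by simp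
      show "Re z + real i \<le> norm (z + of_nat i)"
        using complex_Re_le_cmod[of "z + of_nat i"] by simp
    qed
    ultimately show ?thesis
      by (auto simp: Gamma_series_def norm_mult norm_divide intro!: divide_left_mono mult_pos_pos)
  qed
  thus "\<exists>N. \<forall>n\<ge>N. norm (Gamma_series z n) \<le> Gamma_series (Re z) n" by blast
qed

text \<open>
  Any polynomial decay follows from \<open>\<Gamma>(z) = \<Gamma>(z + m) / (z (z + 1) \<cdots> (z + m - 1))\<close>; the number
  \<open>m > 2/c\<close> of steps makes the \<open>c\<close>-th power integrable.
\<close>

lemma norm_Gamma_strip_bound:
  assumes "\<alpha> > 0" "c > 0"
  obtains B where "\<And>s y. \<alpha> \<le> s \<Longrightarrow> s \<le> \<beta> \<Longrightarrow> norm (Gamma (Complex s y)) powr c \<le> B / (1 + y\<^sup>2)"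
proof -
  obtain m :: nat where m: "real m > 2 / c" using reals_Archimedean2 by blast
  have mc: "real m * c / 2 \<ge> 1" using m assms by (simp add: field_simps)
  \<comment> \<open>Being at most \<alpha> and at most 1, \<mu> satisfies \<mu>^2 (1 + y^2) \<le> (s
    + i)^2 + y^2, so every factor of the Pochhammer product has norm at least \<mu> sqrt (1 + y^2),
    whatever s and i are.\<close>
  define \<mu> where "\<mu> = min \<alpha> 1"
  have \<mu>: "\<mu> > 0" "\<mu> \<le> \<alpha>" "\<mu> \<le> 1" using assms by (auto simp: \<mu>_def)
  have "continuous_on {\<alpha> + real m..\<beta> + real m} (Gamma :: real \<Rightarrow> real)"
    using assms by (intro continuous_on_Gamma) (auto elim!: nonpos_Ints_cases)
  hence "compact ((Gamma :: real \<Rightarrow> real) ` {\<alpha> + real m..\<beta> + real m})"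
    by (intro compact_continuous_image) auto
  then obtain G where G: "\<And>s. \<alpha> \<le> s \<Longrightarrow> s \<le> \<beta> \<Longrightarrow> \<bar>Gamma (s + real m)\<bar> \<le> G"
    by (force dest!: compact_imp_bounded simp: bounded_iff)
  have main: "norm (Gamma (Complex s y)) powr c \<le> (G / \<mu> ^ m) powr c / (1 + y\<^sup>2)"
    if s: "\<alpha> \<le> s" "s \<le> \<beta>" for s y
  proof -
    define z where "z = Complex s y"
    have z: "Re z > 0" using s assms by (simp add: z_def)
    define q where "q = 1 + y\<^sup>2"
    have q: "q \<ge> 1" by (simp add: q_def)
    have "(\<mu> * sqrt q) ^ m \<le> norm (pochhammer z m)"
      unfolding pochhammer_prod prod_norm [symmetric]
    proof -
      have *: "\<mu> * sqrt q \<le> norm (z + of_nat i)" for i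
      proof -
        have "\<mu>\<^sup>2 * q = \<mu>\<^sup>2 + \<mu>\<^sup>2 * y\<^sup>2" by (simp add: q_def algebra_simps)
        also have "\<dots> \<le> (s + real i)\<^sup>2 + 1 * y\<^sup>2"
          using \<mu> s by (intro add_mono mult_right_mono power_mono power_le_one) auto
        finally have "sqrt (\<mu>\<^sup>2 * q) \<le> sqrt ((s + real i)\<^sup>2 + y\<^sup>2)" by simp
        thus ?thesis using \<mu> by (simp add: real_sqrt_mult cmod_def z_def)
      qed
      have "(\<mu> * sqrt q) ^ m = (\<Prod>i=0..<m. \<mu> * sqrt q)" by simp
      also have "\<dots> \<le> (\<Prod>i=0..<m. norm (z + of_nat i))"
        using * \<mu> q by (intro prod_mono) auto
      finally show "(\<mu> * sqrt q) ^ m \<le> (\<Prod>i=0..<m. norm (z + of_nat i))" .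
    qed
    moreover have "0 < (\<mu> * sqrt q) ^ m" using \<mu> q by simp
    moreover have "norm (pochhammer z m) * norm (Gamma z) \<le> G"
    proof -
      have "pochhammer z m * Gamma z = Gamma (z + of_nat m)"
        using pochhammer_Gamma[of z m] Re_pos_not_nonpos_Ints[OF z]
        by (simp add: Gamma_eq_zero_iff field_simps)
      hence "norm (pochhammer z m) * norm (Gamma z) = norm (Gamma (z + of_nat m))"
        by (metis norm_mult)
      also have "\<dots> \<le> Gamma (s + real m)"
        using norm_Gamma_le_Gamma_Re[of "z + of_nat m"] z by (simp add: z_def)
      also have "\<dots> \<le> G" using G[OF s] by simp
      finally show ?thesis .
    qed
    ultimately have "(\<mu> * sqrt q) ^ m * norm (Gamma z) \<le> G"
      by (meson mult_right_mono norm_ge_zero order_trans)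
    hence "norm (Gamma z) \<le> G / (\<mu> ^ m) / sqrt q ^ m"
      using \<mu> q by (simp add: field_simps)
    hence "norm (Gamma z) powr c \<le> (G / (\<mu> ^ m) / sqrt q ^ m) powr c"
      using assms by (intro powr_mono2) auto
    also have "\<dots> = (G / \<mu> ^ m) powr c / (sqrt q ^ m) powr c"
      by (rule powr_divide)
    also have "(sqrt q ^ m) powr c = q powr (real m * c / 2)"
      using q by (simp add: powr_half_sqrt[symmetric] powr_powr flip: powr_realpow)
    also have "(G / \<mu> ^ m) powr c / q powr (real m * c / 2) \<le> (G / \<mu> ^ m) powr c / q powr 1"
      using q mc by (intro divide_left_mono powr_mono mult_pos_pos) auto
    finally show ?thesis using q by (simp add: z_def q_def)
  qed
  thus thesis using that by blast
qed

text \<open>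
  The same quotient with about \<open>2s\<close> steps: the product of the factors \<open>1 + y\<^sup>2 / (s + i)\<^sup>2\<close> bounds
  \<open>|\<Gamma>(s + iy) / \<Gamma>(s)|\<^sup>-\<^sup>2\<close> from below, and Bernoulli's inequality for each half of it gives a square.
\<close>

lemma norm_Gamma_le_uniform:
  assumes s: "s \<ge> 1"
  shows "norm (Gamma (Complex s y)) \<le> Gamma s / (1 + y\<^sup>2 / (25 * s))"
proof -
  define m where "m = nat \<lceil>s\<rceil>"
  have m: "real m \<ge> s" "real m \<le> 2 * s" using s by (auto simp: m_def; linarith)+
  define z where "z = Complex s y"
  have z: "Re z > 0" using s by (simp add: z_def)
  \<comment> \<open>All factors s + i with i < 2m are below s + 2m \<le> 5s. So u is at most y^2 /
    (s + i)^2 for each of them, while m u \<ge> y^2 / (25 s) because m \<ge> s; this is the origin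
    of the 25.\<close>
  define u where "u = y\<^sup>2 / (s + 2 * real m)\<^sup>2"
  have u: "u \<ge> 0" by (simp add: u_def)
  have sn: "Gamma (s + real (2 * m)) = pochhammer s (2 * m) * Gamma s"
  proof -
    have "Gamma s > 0" "s \<notin> \<int>\<^sub>\<le>\<^sub>0" using s by (auto elim!: nonpos_Ints_cases)
    thus ?thesis using pochhammer_Gamma[of s "2 * m"] by simp
  qed
  have zn: "Gamma (z + of_nat (2 * m)) = pochhammer z (2 * m) * Gamma z"
    using pochhammer_Gamma[of z "2 * m"] Re_pos_not_nonpos_Ints[OF z]
    by (simp add: Gamma_eq_zero_iff field_simps)
  have "(pochhammer s (2 * m) * (1 + y\<^sup>2 / (25 * s)))\<^sup>2 \<le> (norm (pochhammer z (2 * m)))\<^sup>2"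
  proof -
    have "1 + y\<^sup>2 / (25 * s) \<le> 1 + real m * u"
    proof -
      have "(s + 2 * real m)\<^sup>2 \<le> (5 * s)\<^sup>2" using m s by (intro power_mono) auto
      also have "\<dots> = 25 * s * s" by (simp add: power2_eq_square)
      also have "\<dots> \<le> 25 * s * real m" using m s by (intro mult_left_mono) auto
      finally have "y\<^sup>2 * (s + 2 * real m)\<^sup>2 \<le> y\<^sup>2 * (25 * s * real m)"
        by (intro mult_left_mono) auto
      thus ?thesis using s by (simp add: u_def field_simps)
    qed
    also have "\<dots> \<le> (1 + u) ^ m" using Bernoulli_inequality[of u m] u by simp
    finally have "(1 + y\<^sup>2 / (25 * s))\<^sup>2 \<le> ((1 + u) ^ m)\<^sup>2"
      using s by (intro power_mono) auto
    also have "\<dots> = (\<Prod>i=0..<2*m. 1 + u)" by (simp flip: power_mult add: mult.commute)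
    finally have 1: "(1 + y\<^sup>2 / (25 * s))\<^sup>2 \<le> (\<Prod>i=0..<2*m. 1 + u)" .
    have "(pochhammer s (2 * m) * (1 + y\<^sup>2 / (25 * s)))\<^sup>2 \<le> 
          (pochhammer s (2 * m))\<^sup>2 * (\<Prod>i=0..<2*m. 1 + u)"
      unfolding power_mult_distrib by (intro mult_left_mono 1) auto
    also have "\<dots> = (\<Prod>i=0..<2*m. (s + real i)\<^sup>2 * (1 + u))"
      by (simp add: pochhammer_prod prod.distrib prod_power_distrib)
    also have "\<dots> \<le> (\<Prod>i=0..<2*m. (norm (z + of_nat i))\<^sup>2)"
    proof (intro prod_mono conjI)
      fix i assume i: "i \<in> {0..<2*m}"
      show "0 \<le> (s + real i)\<^sup>2 * (1 + u)" using u by simp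
      have "(s + real i)\<^sup>2 * y\<^sup>2 \<le> (s + 2 * real m)\<^sup>2 * y\<^sup>2"
        using i s by (intro mult_right_mono power_mono) auto
      hence "(s + real i)\<^sup>2 * u \<le> y\<^sup>2"
        using s by (simp add: u_def field_simps)
      thus "(s + real i)\<^sup>2 * (1 + u) \<le> (norm (z + of_nat i))\<^sup>2"
        by (simp add: z_def cmod_power2 algebra_simps)
    qed
    also have "\<dots> = (norm (pochhammer z (2 * m)))\<^sup>2"
      by (simp add: pochhammer_prod prod_power_distrib flip: prod_norm)
    finally show ?thesis .
  qed
  hence *: "pochhammer s (2 * m) * (1 + y\<^sup>2 / (25 * s)) \<le> norm (pochhammer z (2 * m))"
    by (rule power2_le_imp_le) auto
  have pos: "pochhammer s (2 * m) > 0" using s by (intro pochhammer_pos) auto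
  have "pochhammer s (2 * m) * ((1 + y\<^sup>2 / (25 * s)) * norm (Gamma z)) \<le> norm (pochhammer z (2 * m)) * norm (Gamma z)"
    using mult_right_mono[OF *, of "norm (Gamma z)"] by (simp add: mult.assoc)
  also have "\<dots> = norm (Gamma (z + of_nat (2 * m)))"
    by (simp only: zn norm_mult)
  also have "\<dots> \<le> Gamma (s + real (2 * m))"
    using norm_Gamma_le_Gamma_Re[of "z + of_nat (2 * m)"] s by (simp add: z_def)
  also have "\<dots> = pochhammer s (2 * m) * Gamma s" by (rule sn)
  finally have "(1 + y\<^sup>2 / (25 * s)) * norm (Gamma z) \<le> Gamma s"
    using pos by simp
  moreover have "1 + y\<^sup>2 / (25 * s) > 0" using s by (intro add_pos_nonneg) auto
  ultimately show ?thesis by (simp add: z_def pos_le_divide_eq mult.commute)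
qed

lemma continuous_on_Complex_line: "continuous_on UNIV (\<lambda>y. Complex s y)"
  unfolding Complex_eq by (intro continuous_intros)

lemma integrable_line:
  assumes "continuous_on UNIV (\<lambda>y. f (Complex s y) :: complex)"
    and "\<And>y. norm (f (Complex s y)) \<le> B / (1 + y\<^sup>2)"
  shows "integrable lborel (\<lambda>y. f (Complex s y))"
proof (rule Bochner_Integration.integrable_bound)
  show "integrable lborel (\<lambda>y::real. B * (1 / (1 + y\<^sup>2)))"
    by (intro integrable_mult_right integrable_inverse_1_plus_square)
  show "(\<lambda>y. f (Complex s y)) \<in> borel_measurable lborel"
    using assms(1) by (simp add: borel_measurable_continuous_onI)
  show "AE y in lborel. norm (f (Complex s y)) \<le> norm (B * (1 / (1 + y\<^sup>2)))"
    unfolding real_norm_def by (intro AE_I2 order_trans[OF _ abs_ge_self]) (simp add: assms(2))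
qed

lemma Complex_not_nonpos_Ints: "s \<notin> \<int>\<^sub>\<le>\<^sub>0 \<Longrightarrow> Complex s y \<notin> \<int>\<^sub>\<le>\<^sub>0"
  by (auto elim!: nonpos_Ints_cases simp: complex_eq_iff nonpos_Ints_def)

lemma continuous_on_Gamma_line:
  assumes "s \<notin> \<int>\<^sub>\<le>\<^sub>0"
  shows "continuous_on UNIV (\<lambda>y. Gamma (Complex s y))"
  using Complex_not_nonpos_Ints[OF assms]
  by (intro continuous_on_compose2[OF continuous_on_Gamma[of "UNIV - \<int>\<^sub>\<le>\<^sub>0"] continuous_on_Complex_line])
     auto

text \<open>The bound in \<open>norm_Gamma_le_uniform\<close> is a Cauchy profile in y of width 5
  sqrt s, so rescaling y by this width produces the factor sqrt s. This is the true order of growth,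
  since |Gamma(s + iy)| resembles Gamma(s) exp(-y^2 / (2s)) near the real axis.\<close>

lemma integral_norm_Gamma_le:
  obtains C where "C > 0" "\<And>s. s \<ge> 1 \<Longrightarrow> integrable lborel (\<lambda>y. Gamma (Complex s y))"
    "\<And>s. s \<ge> 1 \<Longrightarrow> (LINT y|lborel. norm (Gamma (Complex s y))) \<le> C * sqrt s * Gamma s"
proof -
  define J where "J = (LINT y|lborel. 1 / (1 + y\<^sup>2 :: real))"
  have J: "J \<ge> 0" unfolding J_def by (intro Bochner_Integration.integral_nonneg) auto
  \<comment> \<open>The \<open>+ 1\<close> makes the constant visibly positive without evaluating
    \<open>J\<close>.\<close>
  have "integrable lborel (\<lambda>y. Gamma (Complex s y)) \<and>
        (LINT y|lborel. norm (Gamma (Complex s y))) \<le> (5 * J + 1) * sqrt s * Gamma s" if s: "s \<ge> 1" for s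
  proof -
    define r where "r = 5 * sqrt s"
    have r: "r > 0" "25 * s = r\<^sup>2" using s by (auto simp: r_def power_mult_distrib)
    have eq: "1 / (1 + (y / r)\<^sup>2) = 1 / (1 + y\<^sup>2 / (25 * s))" for y
      using r by (simp add: power_divide)
    have int: "integrable lborel (\<lambda>y. 1 / (1 + y\<^sup>2 / (25 * s)))"
      using lborel_integrable_real_affine[OF integrable_inverse_1_plus_square, of "1 / r" 0] r(1)
      by (simp add: eq)
    have "J = 1 / r * (LINT y|lborel. 1 / (1 + y\<^sup>2 / (25 * s)))"
      using lborel_integral_real_affine[of "1 / r" "\<lambda>y. 1 / (1 + y\<^sup>2)" 0] r(1)
      by (simp add: eq J_def)
    hence J': "(LINT y|lborel. 1 / (1 + y\<^sup>2 / (25 * s))) = r * J" using r by (simp add: field_simps)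
    have int': "integrable lborel (\<lambda>y. Gamma s * (1 / (1 + y\<^sup>2 / (25 * s))))"
      using int by (rule integrable_mult_right)
    have bd: "norm (Gamma (Complex s y)) \<le> Gamma s * (1 / (1 + y\<^sup>2 / (25 * s)))" for y
      using norm_Gamma_le_uniform[OF s, of y] by simp
    have 1: "integrable lborel (\<lambda>y. Gamma (Complex s y))"
    proof (rule Bochner_Integration.integrable_bound[OF int'])
      show "(\<lambda>y. Gamma (Complex s y)) \<in> borel_measurable lborel"
        using s by (auto intro!: borel_measurable_continuous_onI continuous_on_Gamma_line elim!: nonpos_Ints_cases)
      show "AE y in lborel. norm (Gamma (Complex s y)) \<le> norm (Gamma s * (1 / (1 + y\<^sup>2 / (25 * s))))"
        unfolding real_norm_def by (intro AE_I2 order_trans[OF bd abs_ge_self])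
    qed
    have "(LINT y|lborel. norm (Gamma (Complex s y))) \<le> (LINT y|lborel. Gamma s * (1 / (1 + y\<^sup>2 / (25 * s))))"
      using bd 1 int' by (intro integral_mono integrable_norm)
    also have "\<dots> = Gamma s * (r * J)" by (subst integral_mult_right_zero) (simp only: J')
    also have "\<dots> = (5 * J) * sqrt s * Gamma s" by (simp add: r_def)
    also have "\<dots> \<le> (5 * J + 1) * sqrt s * Gamma s"
      using s by (intro mult_right_mono) auto
    finally show ?thesis using 1 by simp
  qed
  thus thesis using that[of "5 * J + 1"] J by simp
qed

section \<open>Stirling's formula in the right half-plane\<close>

lemma Ln_mult_1_plus:
  assumes "Re s > 0" "Re (1 + v) > 0"
  shows "Ln (s * (1 + v)) = Ln s + Ln (1 + v)"
proof (rule Ln_times_simple)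
  show "- pi < Im (Ln s) + Im (Ln (1 + v))" "Im (Ln s) + Im (Ln (1 + v)) \<le> pi"
    using Re_Ln_pos_lt_imp[OF assms(1)] Re_Ln_pos_lt_imp[OF assms(2)] by linarith+
qed (use assms in \<open>metis less_irrefl zero_complex.sel(1)\<close>)+

lemma Ln_approx_quadratic:
  fixes u :: complex
  assumes "norm u \<le> 1 / 2"
  shows "norm (Ln (1 + u) - (u - u\<^sup>2 / 2)) \<le> norm u ^ 3"
proof -
  have "(\<lambda>n. - ((- u) ^ n) / of_nat n) sums Ln (1 + u)"
    using assms by (intro Ln_series') auto
  from sums_split_initial_segment[OF this, of 3]
  have 1: "(\<lambda>n. - ((- u) ^ (n + 3)) / of_nat (n + 3)) sums (Ln (1 + u) - (u - u\<^sup>2 / 2))"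
    by (simp add: eval_nat_numeral)
  have "(\<lambda>n. norm u ^ 3 / 2 * norm u ^ n) sums (norm u ^ 3 / 2 * (1 / (1 - norm u)))"
    using assms by (intro sums_mult geometric_sums) auto
  hence 2: "norm (Ln (1 + u) - (u - u\<^sup>2 / 2)) \<le> norm u ^ 3 / 2 * (1 / (1 - norm u))"
  proof (rule norm_sums_le[OF 1])
    fix n
    have "norm (- ((- u) ^ (n + 3)) / of_nat (n + 3)) = norm u ^ (n + 3) / real (n + 3)"
      by (simp add: norm_divide norm_power del: of_nat_add)
    also have "\<dots> \<le> norm u ^ (n + 3) / 2" by (intro divide_left_mono) auto
    finally show "norm (- ((- u) ^ (n + 3)) / of_nat (n + 3)) \<le> norm u ^ 3 / 2 * norm u ^ n"
      by (simp add: power_add mult_ac)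
  qed
  also have "\<dots> \<le> norm u ^ 3 / 2 * 2"
    using assms by (intro mult_left_mono) (auto simp: field_simps)
  finally show ?thesis by simp
qed

text \<open>Stirling's approximation of ln Gamma without its constant ln (2 pi) / 2. The recurrence
  of ln Gamma only sees differences, so the constant has to be found by other means.\<close>

definition stirling_main :: "complex \<Rightarrow> complex" where
  "stirling_main z = (z - 1 / 2) * Ln z - z"

text \<open>Measures how far \<open>stirling_main\<close> is from satisfying the recurrence L(s + 1)
  - L(s) = Ln s of ln Gamma. Expanding in u = 1/s, the terms of order u cancel thanks to the 1/2 in
  \<open>z - 1 / 2\<close>; what is left is quadratic in u and therefore summable along s, s + 1, s
  + 2, ...\<close>

lemma stirling_main_step:
  assumes "Re s \<ge> 2"
  shows "norm (stirling_main (s + 1) - stirling_main s - Ln s) \<le> 2 / (norm s)\<^sup>2"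
proof -
  have s: "norm s \<ge> 2" "s \<noteq> 0" using assms complex_Re_le_cmod[of s] by auto
  define u where "u = 1 / s"
  have u: "norm u \<le> 1 / 2" "u \<noteq> 0" "s = 1 / u" using s by (auto simp: u_def norm_divide field_simps)
  define e where "e = Ln (1 + u) - (u - u\<^sup>2 / 2)"
  have e: "norm e \<le> norm u ^ 3" unfolding e_def by (rule Ln_approx_quadratic) (use u in auto)
  have "stirling_main (s + 1) - stirling_main s - Ln s = (s + 1 / 2) * (Ln (s + 1) - Ln s) - 1"
    by (simp add: stirling_main_def algebra_simps)
  also have "Ln (s + 1) - Ln s = u - u\<^sup>2 / 2 + e"
  proof -
    have "Re u > 0" using assms s by (simp add: u_def Re_divide add_pos_nonneg)
    hence "Ln (s * (1 + u)) = Ln s + Ln (1 + u)" using assms by (intro Ln_mult_1_plus) auto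
    moreover have "s * (1 + u) = s + 1" using s by (simp add: u_def field_simps)
    ultimately show ?thesis by (simp add: e_def)
  qed
  also have "(s + 1 / 2) * \<dots> - 1 = (1 / u) * e + e / 2 - u\<^sup>2 / 4"
    using u(2) unfolding u(3) by (simp add: field_simps power2_eq_square)
  finally have "norm (stirling_main (s + 1) - stirling_main s - Ln s) \<le>
      norm ((1 / u) * e) + norm (e / 2) + norm (u\<^sup>2 / 4)"
    by (metis norm_triangle_ineq norm_triangle_ineq4 order_trans add_right_mono)
  also have "norm ((1 / u) * e) \<le> (norm u)\<^sup>2"
    using e u by (simp add: norm_mult norm_divide field_simps power2_eq_square power3_eq_cube)
  also have "norm (e / 2) \<le> (norm u)\<^sup>2 / 4"
  proof -
    have "norm e \<le> (norm u)\<^sup>2 * norm u" using e by (simp add: power2_eq_square power3_eq_cube)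
    also have "\<dots> \<le> (norm u)\<^sup>2 * (1 / 2)" using u by (intro mult_left_mono) auto
    finally show ?thesis by (simp add: norm_divide)
  qed
  also have "norm (u\<^sup>2 / 4) = (norm u)\<^sup>2 / 4" by (simp add: norm_divide norm_power)
  finally have "norm (stirling_main (s + 1) - stirling_main s - Ln s) \<le> 2 * (norm u)\<^sup>2"
    by (simp add: field_simps) (smt (verit) zero_le_power2)
  thus ?thesis by (simp add: u_def norm_divide power_divide)
qed

text \<open>The accumulated defects of the recurrence. A remainder r that corrects
  \<open>stirling_main\<close> must satisfy r(z) - r(z + 1) = defect at z, and if it is to vanish at
  infinity it must be this series.\<close>

definition stirling_rem :: "complex \<Rightarrow> complex" where
  "stirling_rem z = (\<Sum>k. stirling_main (z + of_nat k + 1) - stirling_main (z + of_nat k) - Ln (z + of_nat k))"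

lemma sums_inverse_square_bound:
  fixes x :: real
  assumes "x \<ge> 2"
  shows "(\<lambda>k. 2 * (1 / (x + real k - 1) - 1 / (x + real (Suc k) - 1))) sums (2 * (1 / (x - 1)))"
proof -
  have "(\<lambda>k. 1 / (x + real k - 1)) \<longlonglongrightarrow> 0"
    by real_asymp
  from telescope_sums'[OF this] show ?thesis
    by (intro sums_mult) simp
qed

text \<open>Discarding Im z by |z + k| \<ge> Re z + k makes the estimate uniform on vertical lines,
  and 1/x^2 \<le> 1/(x - 1) - 1/x turns the majorant into a telescoping series.\<close>

lemma stirling_term_bound:
  assumes "Re z \<ge> 2"
  shows "norm (stirling_main (z + of_nat k + 1) - stirling_main (z + of_nat k) - Ln (z + of_nat k)) \<le>
         2 * (1 / (Re z + real k - 1) - 1 / (Re z + real (Suc k) - 1))"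
proof -
  define x where "x = Re z + real k"
  have x: "x \<ge> 2" using assms by (simp add: x_def)
  have "norm (z + of_nat k) \<ge> x" using complex_Re_le_cmod[of "z + of_nat k"] by (simp add: x_def)
  have "norm (stirling_main (z + of_nat k + 1) - stirling_main (z + of_nat k) - Ln (z + of_nat k)) \<le>
        2 / (norm (z + of_nat k))\<^sup>2"
    using assms by (intro stirling_main_step) auto
  also have "\<dots> \<le> 2 / x\<^sup>2"
    using x \<open>norm (z + of_nat k) \<ge> x\<close> by (intro divide_left_mono power_mono mult_pos_pos) auto
  also have "\<dots> \<le> 2 / (x * (x - 1))"
    using x by (intro divide_left_mono mult_pos_pos) (auto simp: power2_eq_square)
  also have "\<dots> = 2 * (1 / (x - 1) - 1 / x)"
    using x by (simp add: field_simps)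
  finally show ?thesis by (simp add: x_def)
qed

lemma
  assumes "Re z \<ge> 2"
  shows stirling_rem_sums: "(\<lambda>k. stirling_main (z + of_nat k + 1) - stirling_main (z + of_nat k) - Ln (z + of_nat k))
           sums stirling_rem z"
    and norm_stirling_rem_le: "norm (stirling_rem z) \<le> 4 / Re z"
proof -
  have "summable (\<lambda>k. stirling_main (z + of_nat k + 1) - stirling_main (z + of_nat k) - Ln (z + of_nat k))"
    by (rule summable_comparison_test'[OF sums_summable[OF sums_inverse_square_bound[OF assms]]])
       (rule stirling_term_bound[OF assms])
  thus 1: "(\<lambda>k. stirling_main (z + of_nat k + 1) - stirling_main (z + of_nat k) - Ln (z + of_nat k))
           sums stirling_rem z"
    unfolding stirling_rem_def by (rule summable_sums)
  have "norm (stirling_rem z) \<le> 2 * (1 / (Re z - 1))"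
    by (rule norm_sums_le[OF 1 sums_inverse_square_bound[OF assms]]) (rule stirling_term_bound[OF assms])
  also have "\<dots> \<le> 4 / Re z" using assms by (simp add: field_simps)
  finally show "norm (stirling_rem z) \<le> 4 / Re z" .
qed

lemma tendsto_mult_Ln_1_plus:
  "(\<lambda>n. of_nat (Suc n) * Ln (1 + z / of_nat (Suc n))) \<longlonglongrightarrow> z"
proof -
  have "(\<lambda>n. of_nat (Suc n) * Ln (1 + z / of_nat (Suc n)) - z) \<longlonglongrightarrow> 0"
  proof (rule Lim_null_comparison)
    have "\<forall>\<^sub>F n in sequentially. real n > 2 * norm z" by real_asymp
    thus "\<forall>\<^sub>F n in sequentially. norm (of_nat (Suc n) * Ln (1 + z / of_nat (Suc n)) - z) \<le>
            2 * (norm z)\<^sup>2 / real (Suc n)"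
    proof eventually_elim
      case (elim n)
      define w where "w = z / of_nat (Suc n)"
      have w: "norm w \<le> 1 / 2" using elim by (simp add: w_def norm_divide field_simps del: of_nat_Suc)
      have "norm (Ln (1 + w) - w) \<le> (norm w)\<^sup>2 / (1 - norm w)"
        using w by (intro Ln_approx_linear) auto
      also have "\<dots> \<le> (norm w)\<^sup>2 / (1 / 2)"
        using w by (intro divide_left_mono mult_pos_pos) auto
      finally have "real (Suc n) * norm (Ln (1 + w) - w) \<le> real (Suc n) * (2 * (norm w)\<^sup>2)"
        by (intro mult_left_mono) auto
      moreover have "of_nat (Suc n) * Ln (1 + w) - z = of_nat (Suc n) * (Ln (1 + w) - w)"
        by (simp add: w_def algebra_simps del: of_nat_Suc)
      ultimately show ?case
        by (simp add: norm_mult w_def norm_divide power2_eq_square field_simps del: of_nat_Suc)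
    qed
    show "(\<lambda>n. 2 * (norm z)\<^sup>2 / real (Suc n)) \<longlonglongrightarrow> 0" by real_asymp
  qed
  thus ?thesis by (simp add: LIM_zero_iff)
qed

text \<open>The boundary term that arises when the telescoping is stopped after n + 1 steps. With m
  = n + 1 and L = Ln (1 + z/m) it equals z (ln n - ln m) - (z - 1/2) L - m L + z, and m L tends to
  z.\<close>

lemma stirling_main_shift_limit:
  assumes "Re z > 0"
  shows "(\<lambda>n. z * ln (of_nat n) - stirling_main (z + of_nat (Suc n)) + stirling_main (of_nat (Suc n))) \<longlonglongrightarrow> 0"
proof -
  define L where "L = (\<lambda>n. Ln (1 + z / of_nat (Suc n)))"
  have L0: "L \<longlonglongrightarrow> 0"
  proof -
    have "(\<lambda>n. (of_nat (Suc n) * L n) * of_real (1 / real (Suc n))) \<longlonglongrightarrow> z * of_real 0"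
      unfolding L_def by (intro tendsto_mult tendsto_mult_Ln_1_plus tendsto_of_real) real_asymp
    thus ?thesis by (simp del: of_nat_Suc)
  qed
  have ln0: "(\<lambda>n. complex_of_real (ln (real n) - ln (real (Suc n)))) \<longlonglongrightarrow> of_real 0"
    by (intro tendsto_of_real) real_asymp
  have "(\<lambda>n. z * of_real (ln (real n) - ln (real (Suc n))) - (z - 1 / 2) * L n
          - of_nat (Suc n) * L n + z) \<longlonglongrightarrow> z * of_real 0 - (z - 1 / 2) * 0 - z + z"
    by (intro tendsto_intros ln0 L0) (unfold L_def, rule tendsto_mult_Ln_1_plus)
  hence lim: "(\<lambda>n. z * of_real (ln (real n) - ln (real (Suc n))) - (z - 1 / 2) * L n
          - of_nat (Suc n) * L n + z) \<longlonglongrightarrow> 0" by simp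
  show ?thesis
  proof (rule Lim_transform_eventually[OF lim])
    show "\<forall>\<^sub>F n in sequentially. z * of_real (ln (real n) - ln (real (Suc n))) - (z - 1 / 2) * L n
          - of_nat (Suc n) * L n + z = z * ln (of_nat n) - stirling_main (z + of_nat (Suc n)) + stirling_main (of_nat (Suc n))"
      using eventually_gt_at_top[of 0]
    proof eventually_elim
      case (elim n)
      define m where "m = real (Suc n)"
      have m: "m > 0" by (simp add: m_def)
      have "Ln (of_real m * (1 + z / of_real m)) = Ln (of_real m) + Ln (1 + z / of_real m)"
      proof (rule Ln_times_of_real[OF m])
        have "Re (1 + z / of_real m) > 0" using assms m by (simp add: Re_divide_of_real add_pos_pos)
        thus "1 + z / of_real m \<noteq> 0" by (metis less_irrefl zero_complex.sel(1))
      qed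
      also have "of_real m * (1 + z / of_real m) = z + of_real m" using m by (simp add: field_simps)
      finally have "Ln (z + of_nat (Suc n)) = of_real (ln (real (Suc n))) + L n"
        using Ln_of_real[OF m] by (simp add: m_def L_def)
      moreover have "Ln (of_nat (Suc n)) = of_real (ln (real (Suc n)))"
        using Ln_of_real[of "real (Suc n)"] by simp
      moreover have "Ln (of_nat n) = of_real (ln (real n))"
        using Ln_of_real[of "real n"] elim by simp
      ultimately show ?case
        unfolding stirling_main_def by (simp add: algebra_simps)
    qed
  qed
qed

text \<open>The grouping is chosen so that the first bracket tends to 0, the last sum tends to
  \<open>stirling_rem z\<close>, and the second bracket does not involve z: its limit will be the
  constant.\<close>

lemma ln_Gamma_series_telescope:
  assumes "Re z > 0"
  shows "ln_Gamma_series z n = (z * ln (of_nat n) - stirling_main (z + of_nat (Suc n)) + stirling_main (of_nat (Suc n)))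
     + (of_real (\<Sum>k=1..n. ln (real k)) - stirling_main (of_nat (Suc n))) + stirling_main z
     + (\<Sum>k<Suc n. stirling_main (z + of_nat k + 1) - stirling_main (z + of_nat k) - Ln (z + of_nat k))"
proof -
  have "(\<Sum>k<Suc n. stirling_main (z + of_nat k + 1) - stirling_main (z + of_nat k)) =
        stirling_main (z + of_nat (Suc n)) - stirling_main z"
    using sum_lessThan_telescope[of "\<lambda>k. stirling_main (z + of_nat k)" "Suc n"]
    by (simp only: of_nat_Suc of_nat_0 add_0_right add.assoc add.commute[of 1])
  hence 1: "(\<Sum>k<Suc n. stirling_main (z + of_nat k + 1) - stirling_main (z + of_nat k) - Ln (z + of_nat k))
      = stirling_main (z + of_nat (Suc n)) - stirling_main z - (\<Sum>k<Suc n. Ln (z + of_nat k))"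
    by (simp only: sum_subtractf)
  have "(\<Sum>k=1..n. ln (z / of_nat k + 1)) = (\<Sum>k=1..n. Ln (z + of_nat k) - of_real (ln (real k)))"
  proof (intro sum.cong refl)
    fix k assume k: "k \<in> {1..n}"
    have "Re (z + of_nat k) > 0" using assms by simp
    hence "z + of_nat k \<noteq> 0" by (metis less_irrefl zero_complex.sel(1))
    hence "Ln ((z + of_nat k) / of_real (real k)) = Ln (z + of_nat k) - ln (real k)"
      using k by (intro Ln_divide_of_real) auto
    thus "ln (z / of_nat k + 1) = Ln (z + of_nat k) - of_real (ln (real k))"
      using k by (simp add: add_divide_distrib)
  qed
  also have "\<dots> = (\<Sum>k=1..n. Ln (z + of_nat k)) - of_real (\<Sum>k=1..n. ln (real k))"
    by (simp add: sum_subtractf)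
  finally have 2: "(\<Sum>k=1..n. ln (z / of_nat k + 1)) = \<dots>" .
  have "{..<Suc n} = insert 0 {1..n}" by auto
  hence 3: "(\<Sum>k<Suc n. Ln (z + of_nat k)) = Ln z + (\<Sum>k=1..n. Ln (z + of_nat k))"
    by simp
  show ?thesis unfolding ln_Gamma_series_def 1 2 3 by simp
qed

text \<open>Solving the telescoped series for its z-free part \<open>q\<close> shows that one and
  the same sequence converges to ln_Gamma z - stirling_main z - stirling_rem z for every z, so this
  difference cannot depend on z.\<close>

lemma stirling_constant:
  obtains K :: real where "\<And>z. Re z \<ge> 2 \<Longrightarrow> ln_Gamma z = stirling_main z + stirling_rem z + of_real K"
proof -
  define q where "q = (\<lambda>n. complex_of_real (\<Sum>k=1..n. ln (real k)) - stirling_main (of_nat (Suc n)))"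
  have lim: "q \<longlonglongrightarrow> ln_Gamma z - stirling_main z - stirling_rem z" if z: "Re z \<ge> 2" for z
  proof -
    have "Re z > 0" using z by simp
    have "(\<lambda>n. ln_Gamma_series z n - stirling_main z -
        (\<Sum>k<Suc n. stirling_main (z + of_nat k + 1) - stirling_main (z + of_nat k) - Ln (z + of_nat k))
        - (z * ln (of_nat n) - stirling_main (z + of_nat (Suc n)) + stirling_main (of_nat (Suc n))))
      \<longlonglongrightarrow> ln_Gamma z - stirling_main z - stirling_rem z - 0"
      using z by (intro tendsto_diff tendsto_const ln_Gamma_complex_LIMSEQ stirling_main_shift_limit
                    Re_pos_not_nonpos_Ints LIMSEQ_Suc[OF stirling_rem_sums[unfolded sums_def]]) auto
    thus ?thesis
      unfolding ln_Gamma_series_telescope[OF \<open>Re z > 0\<close>] q_def by (simp add: algebra_simps)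
  qed
  have real: "q n \<in> \<real>" for n
  proof -
    have "of_nat (Suc n) = complex_of_real (real (Suc n))" by simp
    hence "stirling_main (of_nat (Suc n)) = of_real ((real (Suc n) - 1 / 2) * ln (real (Suc n)) - real (Suc n))"
      unfolding stirling_main_def using Ln_of_real[of "real (Suc n)"] by (simp del: of_nat_Suc)
    thus ?thesis unfolding q_def by (metis Reals_diff Reals_of_real)
  qed
  \<comment> \<open>The constant is real as a limit of real numbers, which allows it to be computed
    from real arguments later; the point 2 merely serves as the reference value.\<close>
  have "ln_Gamma 2 - stirling_main 2 - stirling_rem 2 \<in> \<real>"
    using real by (intro closed_sequentially[OF closed_complex_Reals _ lim]) auto
  then obtain K where K: "ln_Gamma 2 - stirling_main 2 - stirling_rem 2 = of_real K"
    by (elim Reals_cases)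
  have "ln_Gamma z = stirling_main z + stirling_rem z + of_real K" if "Re z \<ge> 2" for z
    using LIMSEQ_unique[OF lim[OF that] lim[of 2]] K by (simp add: algebra_simps)
  thus thesis using that by blast
qed

lemma ln_Gamma_duplication_real:
  fixes x :: real
  assumes "x > 0"
  shows "ln_Gamma x + ln_Gamma (x + 1 / 2) = (1 - 2 * x) * ln 2 + ln pi / 2 + ln_Gamma (2 * x)"
proof -
  have "Gamma (complex_of_real x) * Gamma (complex_of_real x + 1 / 2) =
        exp ((1 - 2 * complex_of_real x) * of_real (ln 2)) * of_real (sqrt pi) * Gamma (2 * complex_of_real x)"
    using assms by (intro Gamma_legendre_duplication Re_pos_not_nonpos_Ints) auto
  also have "complex_of_real x + 1 / 2 = of_real (x + 1 / 2)" by simp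
  also have "2 * complex_of_real x = of_real (2 * x)" by simp
  also have "1 - of_real (2 * x) = complex_of_real (1 - 2 * x)" by simp
  finally have "Gamma x * Gamma (x + 1 / 2) = exp ((1 - 2 * x) * ln 2) * sqrt pi * Gamma (2 * x)"
    unfolding Gamma_complex_of_real exp_of_real of_real_mult [symmetric] of_real_eq_iff .
  hence "ln (Gamma x * Gamma (x + 1 / 2)) = ln (exp ((1 - 2 * x) * ln 2) * sqrt pi * Gamma (2 * x))"
    by simp
  moreover have "Gamma x > 0" "Gamma (x + 1 / 2) > 0" "Gamma (2 * x) > 0" using assms by auto
  ultimately show ?thesis using assms by (simp add: ln_mult_pos ln_Gamma_real_pos ln_sqrt)
qed

theorem stirling_ln_Gamma:
  assumes "Re z \<ge> 2"
  shows "norm (ln_Gamma z - (stirling_main z + of_real (ln (2 * pi) / 2))) \<le> 4 / Re z"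
proof -
  obtain K where K: "\<And>z. Re z \<ge> 2 \<Longrightarrow> ln_Gamma z = stirling_main z + stirling_rem z + of_real K"
    using stirling_constant by metis
  define R where "R = (\<lambda>x::real. ln_Gamma x - ((x - 1 / 2) * ln x - x) - K)"
  have R: "\<bar>R x\<bar> \<le> 4 / x" if "x \<ge> 2" for x
  proof -
    have "complex_of_real (R x) = stirling_rem (of_real x)"
      using K[of "of_real x"] that
      by (simp add: R_def stirling_main_def ln_Gamma_complex_of_real Ln_of_real)
    thus ?thesis using norm_stirling_rem_le[of "of_real x"] that by (metis Re_complex_of_real norm_of_real)
  qed
  have R0: "(R \<longlongrightarrow> 0) at_top"
  proof (rule Lim_null_comparison)
    show "\<forall>\<^sub>F x in at_top. norm (R x) \<le> 4 / x"
      using eventually_ge_at_top[of 2] by eventually_elim (use R in simp)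
    show "((\<lambda>x::real. 4 / x) \<longlongrightarrow> 0) at_top" by real_asymp
  qed
  \<comment> \<open>Stirling's formula with the unknown K is put into the logarithm of the
    duplication formula. There K occurs twice on one side and once on the other, so one copy
    remains; the other terms are the vanishing remainders \<open>R\<close> and an elementary
    expression with limit ln 2 / 2 + ln pi / 2.\<close>
  have "((\<lambda>x. R (2 * x) - R x - R (x + 1 / 2)) \<longlongrightarrow> 0 - 0 - 0) at_top"
    by (intro tendsto_diff filterlim_compose[OF R0]) (real_asymp | rule filterlim_ident)+
  moreover have "((\<lambda>x::real. (1 - 2 * x) * ln 2 + ln pi / 2 + ((2 * x - 1 / 2) * (ln 2 + ln x) - 2 * x) 
      - ((x - 1 / 2) * ln x - x) - (x * ln (x + 1 / 2) - (x + 1 / 2))) \<longlongrightarrow> ln 2 / 2 + ln pi / 2) at_top"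
    by real_asymp
  ultimately have "((\<lambda>x. (R (2 * x) - R x - R (x + 1 / 2)) + ((1 - 2 * x) * ln 2 + ln pi / 2 + ((2 * x - 1 / 2) * (ln 2 + ln x) - 2 * x) 
      - ((x - 1 / 2) * ln x - x) - (x * ln (x + 1 / 2) - (x + 1 / 2)))) \<longlongrightarrow> (0 - 0 - 0) + (ln 2 / 2 + ln pi / 2)) at_top"
    by (rule tendsto_add)
  moreover have "\<forall>\<^sub>F x in at_top. (R (2 * x) - R x - R (x + 1 / 2)) + ((1 - 2 * x) * ln 2 + ln pi / 2 + ((2 * x - 1 / 2) * (ln 2 + ln x) - 2 * x) 
      - ((x - 1 / 2) * ln x - x) - (x * ln (x + 1 / 2) - (x + 1 / 2))) = K"
    using eventually_gt_at_top[of 0]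
  proof eventually_elim
    case (elim x)
    have "ln (2 * x) = ln 2 + ln x" using elim by (simp add: ln_mult)
    thus ?case using ln_Gamma_duplication_real[OF elim] by (simp add: R_def algebra_simps add_divide_distrib)
  qed
  ultimately have "((\<lambda>_::real. K) \<longlongrightarrow> (0 - 0 - 0) + (ln 2 / 2 + ln pi / 2)) at_top"
    by (rule Lim_transform_eventually)
  hence K': "K = ln (2 * pi) / 2"
    by (simp add: tendsto_const_iff ln_mult add_divide_distrib)
  have "ln_Gamma z - (stirling_main z + of_real (ln (2 * pi) / 2)) = stirling_rem z"
    unfolding K'[symmetric] K[OF assms] by simp
  thus ?thesis using norm_stirling_rem_le[OF assms] by simp
qed

section \<open>Moving vertical lines of integration\<close>

lemma tendsto_integral_symmetric_interval:
  fixes f :: "real \<Rightarrow> complex"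
  assumes "integrable lborel f"
  shows "(\<lambda>n. integral {-real n..real n} f) \<longlonglongrightarrow> (LINT y|lborel. f y)"
proof -
  have meas [measurable]: "f \<in> borel_measurable lborel" using assms by auto
  have "(\<lambda>n. LINT y|lborel. indicator {-real n..real n} y *\<^sub>R f y) \<longlonglongrightarrow> (LINT y|lborel. f y)"
  proof (rule integral_dominated_convergence[where w = "\<lambda>y. norm (f y)"])
    show "AE y in lborel. (\<lambda>n. indicator {-real n..real n} y *\<^sub>R f y) \<longlonglongrightarrow> f y"
    proof (intro AE_I2 tendsto_eventually)
      fix y :: real
      have "\<forall>\<^sub>F n in sequentially. real n \<ge> \<bar>y\<bar>" by real_asymp
      thus "\<forall>\<^sub>F n in sequentially. indicator {-real n..real n} y *\<^sub>R f y = f y"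
        by eventually_elim (auto simp: indicator_def)
    qed
    show "AE y in lborel. norm (indicator {-real n..real n} y *\<^sub>R f y) \<le> norm (f y)" for n
      by (intro AE_I2) (auto simp: indicator_def)
  qed (use assms in auto)
  moreover have "(LINT y|lborel. indicator {-real n..real n} y *\<^sub>R f y) = integral {-real n..real n} f" for n
  proof -
    have "set_integrable lborel {-real n..real n} f"
      unfolding set_integrable_def by (intro integrable_mult_indicator assms) auto
    from set_borel_integral_eq_integral(2)[OF this] show ?thesis
      by (simp add: set_lebesgue_integral_def)
  qed
  ultimately show ?thesis by simp
qed

text \<open>\<open>r\<close> plays the role of the sum of residues between the two lines. Assuming
  the contour integral itself covers both Cauchy's theorem (r = 0) and the crossing of a pole, and
  asking for decay only when \<bar>y\<bar> \<ge> 1 leaves room for poles on the real axis. The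
  factor \<i> disappears because dz = \<i> dy on vertical lines.\<close>

lemma vertical_line_integral_shift:
  fixes h :: "complex \<Rightarrow> complex" and r :: complex
  assumes "\<alpha> < \<beta>"
    and int: "integrable lborel (\<lambda>y. h (Complex \<alpha> y))" "integrable lborel (\<lambda>y. h (Complex \<beta> y))"
    and rect: "\<And>R. R > 0 \<Longrightarrow> (h has_contour_integral (of_real (2 * pi) * \<i> * r)) (rectpath (Complex \<alpha> (-R)) (Complex \<beta> R))"
    and decay: "\<And>s y. \<alpha> \<le> s \<Longrightarrow> s \<le> \<beta> \<Longrightarrow> 1 \<le> \<bar>y\<bar> \<Longrightarrow> norm (h (Complex s y)) \<le> B / (1 + y\<^sup>2)"
  shows "(LINT y|lborel. h (Complex \<beta> y)) = (LINT y|lborel. h (Complex \<alpha> y)) + of_real (2 * pi) * r"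
proof -
  \<comment> \<open>Up to the factor \<i>, this is minus the contribution of the two horizontal
    sides of the rectangle of half-height n, to which the decay hypothesis applies.\<close>
  define D where "D = (\<lambda>n. integral {-real n..real n} (\<lambda>y. h (Complex \<beta> y)) -
                            integral {-real n..real n} (\<lambda>y. h (Complex \<alpha> y)) - 2 * pi * r)"
  have bound: "norm (D n) \<le> 2 * (B / (1 + (real n)\<^sup>2) * (\<beta> - \<alpha>))" if n: "n \<ge> 1" for n
  proof -
    define R where "R = real n"
    have R: "R \<ge> 1" using n by (simp add: R_def)
    define l1 where "l1 = linepath (Complex \<alpha> (-R)) (Complex \<beta> (-R))"
    define l2 where "l2 = linepath (Complex \<beta> (-R)) (Complex \<beta> R)"
    define l3 where "l3 = linepath (Complex \<beta> R) (Complex \<alpha> R)"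
    define l4 where "l4 = linepath (Complex \<alpha> (-R)) (Complex \<alpha> R)"
    have rp: "rectpath (Complex \<alpha> (-R)) (Complex \<beta> R) = l1 +++ l2 +++ l3 +++ reversepath l4"
      by (simp add: rectpath_def Let_def l1_def l2_def l3_def l4_def)
    have vp: "valid_path l1" "valid_path l2" "valid_path l3" "valid_path l4" "valid_path (reversepath l4)"
      "pathfinish l1 = pathstart l2" "pathfinish l2 = pathstart l3" "pathfinish l3 = pathstart (reversepath l4)"
      by (simp_all add: l1_def l2_def l3_def l4_def)
    have hc: "(h has_contour_integral (of_real (2 * pi) * \<i> * r)) (l1 +++ l2 +++ l3 +++ reversepath l4)"
      using rect[of R] R rp by simp
    hence "h contour_integrable_on (l1 +++ l2 +++ l3 +++ reversepath l4)"
      by (auto simp: contour_integrable_on_def)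
    hence ci: "h contour_integrable_on l1" "h contour_integrable_on l2" "h contour_integrable_on l3"
      "h contour_integrable_on reversepath l4"
      using vp by (auto simp: contour_integrable_join)
    have "2 * pi * \<i> * r = contour_integral l1 h + contour_integral l2 h + contour_integral l3 h
             - contour_integral l4 h"
      using contour_integral_unique[OF hc] vp ci
      by (simp add: contour_integrable_joinI contour_integral_reversepath algebra_simps)
    also have "contour_integral l2 h = \<i> * integral {-R..R} (\<lambda>y. h (Complex \<beta> y))"
      unfolding l2_def using R by (intro contour_integral_linepath_same_Re) auto
    also have "contour_integral l4 h = \<i> * integral {-R..R} (\<lambda>y. h (Complex \<alpha> y))"
      unfolding l4_def using R by (intro contour_integral_linepath_same_Re) auto
    finally have "\<i> * D n = - (contour_integral l1 h + contour_integral l3 h)"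
      by (simp add: D_def R_def algebra_simps)
    hence "norm (D n) = norm (contour_integral l1 h + contour_integral l3 h)"
      by (metis mult_1 norm_ii norm_minus_cancel norm_mult)
    also have "\<dots> \<le> norm (contour_integral l1 h) + norm (contour_integral l3 h)"
      by (rule norm_triangle_ineq)
    also have "norm (contour_integral l1 h) \<le> B / (1 + R\<^sup>2) * norm (Complex \<beta> (-R) - Complex \<alpha> (-R))"
      unfolding l1_def
    proof (rule contour_integral_bound_linepath)
      show "h contour_integrable_on linepath (Complex \<alpha> (-R)) (Complex \<beta> (-R))"
        using ci by (simp add: l1_def)
      show "norm (h z) \<le> B / (1 + R\<^sup>2)" if "z \<in> closed_segment (Complex \<alpha> (-R)) (Complex \<beta> (-R))" for z
        using decay[of "Re z" "-R", unfolded complex_surj] that assms(1) R complex_surj[of z]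
        by (auto simp: closed_segment_same_Im closed_segment_eq_real_ivl)
      show "0 \<le> B / (1 + R\<^sup>2)"
        using decay[of \<alpha> R] R assms(1) norm_ge_zero[of "h (Complex \<alpha> R)"] by linarith
    qed
    also have "norm (contour_integral l3 h) \<le> B / (1 + R\<^sup>2) * norm (Complex \<alpha> R - Complex \<beta> R)"
      unfolding l3_def
    proof (rule contour_integral_bound_linepath)
      show "h contour_integrable_on linepath (Complex \<beta> R) (Complex \<alpha> R)"
        using ci by (simp add: l3_def)
      show "norm (h z) \<le> B / (1 + R\<^sup>2)" if "z \<in> closed_segment (Complex \<beta> R) (Complex \<alpha> R)" for z
        using decay[of "Re z" R] that assms(1) R complex_surj[of z]
        by (auto simp: closed_segment_same_Im closed_segment_eq_real_ivl)
      show "0 \<le> B / (1 + R\<^sup>2)"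
        using decay[of \<alpha> R] R assms(1) norm_ge_zero[of "h (Complex \<alpha> R)"] by linarith
    qed
    finally show ?thesis using assms(1) by (simp add: R_def norm_complex_def)
  qed
  have "D \<longlonglongrightarrow> 0"
  proof (rule Lim_null_comparison)
    show "\<forall>\<^sub>F n in sequentially. norm (D n) \<le> 2 * (B / (1 + (real n)\<^sup>2) * (\<beta> - \<alpha>))"
      using eventually_ge_at_top[of 1] by eventually_elim (rule bound)
    show "(\<lambda>n. 2 * (B / (1 + (real n)\<^sup>2) * (\<beta> - \<alpha>))) \<longlonglongrightarrow> 0" by real_asymp
  qed
  moreover have "D \<longlonglongrightarrow> (LINT y|lborel. h (Complex \<beta> y)) - (LINT y|lborel. h (Complex \<alpha> y)) - 2 * pi * r"
    unfolding D_def by (intro tendsto_diff tendsto_const tendsto_integral_symmetric_interval int)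
  ultimately have "(LINT y|lborel. h (Complex \<beta> y)) - (LINT y|lborel. h (Complex \<alpha> y)) - 2 * pi * r = 0"
    by (rule LIMSEQ_unique[symmetric])
  thus ?thesis by (simp add: algebra_simps)
qed

section \<open>The kernel with a power of Gamma on vertical lines\<close>

lemma norm_of_real_powr_complex: "X > 0 \<Longrightarrow> norm (complex_of_real X powr z) = X powr Re z"
  by (simp add: norm_powr_real_powr)

lemma powr_le_strip:
  fixes X :: real
  assumes "X > 0" "\<alpha> \<le> s" "s \<le> \<beta>"
  shows "X powr (- s) \<le> X powr (- \<alpha>) + X powr (- \<beta>)"
proof (cases "X \<ge> 1")
  case True
  hence "X powr (- s) \<le> X powr (- \<alpha>)" using assms by (intro powr_mono) auto
  thus ?thesis by (smt (verit) powr_ge_zero)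
next
  case False
  hence "X powr (- s) \<le> X powr (- \<beta>)" using assms by (intro powr_mono') auto
  thus ?thesis by (smt (verit) powr_ge_zero)
qed

text \<open>Writing the power of Gamma through \<open>ln_Gamma\<close> keeps the kernel holomorphic
  in the right half-plane for every real c. For c = 1 it is the Mellin kernel X^(-z) Gamma(z)
  there.\<close>

definition Gamma_power_kernel :: "real \<Rightarrow> real \<Rightarrow> complex \<Rightarrow> complex" where
  "Gamma_power_kernel c X z = of_real X powr (- z) * exp (of_real c * ln_Gamma z)"

lemma exp_ln_Gamma_complex: "Re z > 0 \<Longrightarrow> exp (ln_Gamma z) = (Gamma z :: complex)"
  using Re_pos_not_nonpos_Ints by (simp add: Gamma_complex_altdef)

lemma norm_Gamma_power_kernel:
  assumes "X > 0" "Re z > 0"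
  shows "norm (Gamma_power_kernel c X z) = X powr (- Re z) * norm (Gamma z) powr c"
proof -
  have "norm (exp (of_real c * ln_Gamma z)) = norm (exp (ln_Gamma z)) powr c"
    by (simp add: norm_exp_eq_Re powr_def)
  thus ?thesis
    unfolding Gamma_power_kernel_def norm_mult norm_of_real_powr_complex[OF assms(1)]
      exp_ln_Gamma_complex[OF assms(2)] by simp
qed

lemma Gamma_power_kernel_strip_bound:
  assumes "X > 0" "c > 0" "\<alpha> > 0"
  obtains B where "\<And>s y. \<alpha> \<le> s \<Longrightarrow> s \<le> \<beta> \<Longrightarrow> norm (Gamma_power_kernel c X (Complex s y)) \<le> B / (1 + y\<^sup>2)"
proof -
  obtain B where B: "\<And>s y. \<alpha> \<le> s \<Longrightarrow> s \<le> \<beta> \<Longrightarrow> norm (Gamma (Complex s y)) powr c \<le> B / (1 + y\<^sup>2)"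
    using norm_Gamma_strip_bound[OF assms(3,2)] by metis
  have "norm (Gamma_power_kernel c X (Complex s y)) \<le> ((X powr (- \<alpha>) + X powr (- \<beta>)) * B) / (1 + y\<^sup>2)"
    if "\<alpha> \<le> s" "s \<le> \<beta>" for s y
  proof -
    have "X powr (- s) * norm (Gamma (Complex s y)) powr c \<le> (X powr (- \<alpha>) + X powr (- \<beta>)) * (B / (1 + y\<^sup>2))"
      using that assms by (intro mult_mono powr_le_strip B) auto
    thus ?thesis using that assms by (simp add: norm_Gamma_power_kernel)
  qed
  thus thesis using that by blast
qed

lemma holomorphic_Gamma_power_kernel:
  assumes "X > 0"
  shows "Gamma_power_kernel c X holomorphic_on {z. Re z > 0}"
  unfolding Gamma_power_kernel_def using assms
  by (intro holomorphic_intros) (auto simp: complex_nonpos_Reals_iff)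

lemma integrable_Gamma_power_kernel:
  assumes "X > 0" "c > 0" "s > 0"
  shows "integrable lborel (\<lambda>y. Gamma_power_kernel c X (Complex s y))"
proof -
  obtain B where "\<And>s' y. s \<le> s' \<Longrightarrow> s' \<le> s \<Longrightarrow> norm (Gamma_power_kernel c X (Complex s' y)) \<le> B / (1 + y\<^sup>2)"
    using Gamma_power_kernel_strip_bound[OF assms] by metis
  thus ?thesis using assms
    by (intro integrable_line continuous_on_compose2[OF holomorphic_on_imp_continuous_on[OF
          holomorphic_Gamma_power_kernel] continuous_on_Complex_line]) auto
qed

lemma integral_Gamma_power_kernel_shift:
  assumes "X > 0" "c > 0" "s > 0" "s' > 0"
  shows "(LINT y|lborel. Gamma_power_kernel c X (Complex s y)) = (LINT y|lborel. Gamma_power_kernel c X (Complex s' y))"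
proof -
  have *: "(LINT y|lborel. Gamma_power_kernel c X (Complex \<beta> y)) = (LINT y|lborel. Gamma_power_kernel c X (Complex \<alpha> y))"
    if \<alpha>: "0 < \<alpha>" "\<alpha> < \<beta>" for \<alpha> \<beta>
  proof -
    obtain B where B: "\<And>s y. \<alpha> \<le> s \<Longrightarrow> s \<le> \<beta> \<Longrightarrow> norm (Gamma_power_kernel c X (Complex s y)) \<le> B / (1 + y\<^sup>2)"
      using Gamma_power_kernel_strip_bound[OF assms(1,2) \<alpha>(1)] by metis
    have "(LINT y|lborel. Gamma_power_kernel c X (Complex \<beta> y)) = (LINT y|lborel. Gamma_power_kernel c X (Complex \<alpha> y)) + complex_of_real (2 * pi) * 0"
    proof (rule vertical_line_integral_shift[OF \<alpha>(2)])
      show "(Gamma_power_kernel c X has_contour_integral complex_of_real (2 * pi) * \<i> * 0) (rectpath (Complex \<alpha> (-R)) (Complex \<beta> R))"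
        if "R > 0" for R
      proof -
        have "(Gamma_power_kernel c X has_contour_integral 0) (rectpath (Complex \<alpha> (-R)) (Complex \<beta> R))"
          using \<alpha> that assms
          by (intro Cauchy_theorem_convex_simple[OF holomorphic_Gamma_power_kernel] convex_halfspace_Re_gt)
             (auto simp: path_image_rectpath)
        thus ?thesis by simp
      qed
    qed (use \<alpha> assms B in \<open>auto intro: integrable_Gamma_power_kernel\<close>)
    thus ?thesis by simp
  qed
  show ?thesis using *[of s s'] *[of s' s] assms by (cases s s' rule: linorder_cases) auto
qed

section \<open>The inverse Mellin transform of Gamma\<close>

lemma half_minus_nat_not_nonpos_Ints: "1 / 2 - real n \<notin> \<int>\<^sub>\<le>\<^sub>0"
proof
  assume "1 / 2 - real n \<in> \<int>\<^sub>\<le>\<^sub>0"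
  then obtain k :: int where "1 / 2 - real n = of_int k" by (auto elim: nonpos_Ints_cases)
  hence "of_int (1 - 2 * int n) = (of_int (2 * k) :: real)" by simp
  hence "1 - 2 * int n = 2 * k" by (simp only: of_int_eq_iff)
  thus False by presburger
qed

lemma Gamma_eq_shifted:
  fixes z :: complex
  assumes "z \<notin> \<int>\<^sub>\<le>\<^sub>0"
  shows "Gamma z = Gamma (z + of_nat n) / pochhammer z n"
proof -
  have "pochhammer z n \<noteq> 0" using assms by (auto simp: pochhammer_eq_0_iff)
  thus ?thesis using pochhammer_Gamma[OF assms, of n] assms
    by (metis Gamma_eq_zero_iff nonzero_mult_div_cancel_left nonzero_mult_div_cancel_right
          times_divide_eq_right)
qed

text \<open>Lines with real part 1/2 - n run midway between poles. Returning to Re z = 1/2 takes n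
  steps of the recurrence, whose product has factorial size uniformly in y; this later beats the
  growth of X^n for every X.\<close>

lemma norm_Gamma_left_line:
  "norm (Gamma (Complex (1 / 2 - real n) y)) \<le> norm (Gamma (Complex (1 / 2) y)) / pochhammer (1 / 2) n"
proof -
  define z where "z = Complex (1 / 2 - real n) y"
  have "z \<notin> \<int>\<^sub>\<le>\<^sub>0"
    unfolding z_def by (intro Complex_not_nonpos_Ints half_minus_nat_not_nonpos_Ints)
  hence "norm (Gamma z) = norm (Gamma (z + of_nat n)) / norm (pochhammer z n)"
    by (subst Gamma_eq_shifted[of z n]) (simp_all add: norm_divide)
  also have "z + of_nat n = Complex (1 / 2) y"
    by (simp add: z_def complex_eq_iff)
  also have "norm (Gamma (Complex (1 / 2) y)) / norm (pochhammer z n) \<le>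
             norm (Gamma (Complex (1 / 2) y)) / pochhammer (1 / 2) n"
  proof (intro divide_left_mono mult_pos_pos)
    show pos: "0 < pochhammer (1 / 2 :: real) n" by (intro pochhammer_pos) auto
    have "pochhammer (1 / 2) n = (\<Prod>i=0..<n. 1 / 2 + real i)" by (simp add: pochhammer_prod)
    \<comment> \<open>The product is reversed because |Re (z + i)| = 1/2 + (n - 1 - i): starting
      from 1/2 - n, the real parts approach 0 from the left.\<close>
    also have "\<dots> = (\<Prod>i=0..<n. 1 / 2 + real (n - Suc i))"
      by (rule prod.reindex_bij_witness[of _ "\<lambda>i. n - Suc i" "\<lambda>i. n - Suc i"]) auto
    also have "\<dots> \<le> (\<Prod>i=0..<n. norm (z + of_nat i))"
    proof (intro prod_mono conjI)
      fix i assume "i \<in> {0..<n}"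
      thus "1 / 2 + real (n - Suc i) \<le> norm (z + of_nat i)"
        using abs_Re_le_cmod[of "z + of_nat i"] by (simp add: z_def of_nat_diff)
    qed auto
    also have "\<dots> = norm (pochhammer z n)" by (simp add: pochhammer_prod prod_norm)
    finally show "pochhammer (1 / 2) n \<le> norm (pochhammer z n)" .
    thus "0 < norm (pochhammer z n)" using pos by linarith
  qed simp
  finally show ?thesis unfolding z_def .
qed

lemma continuous_on_Mellin_Gamma_line:
  assumes "X > 0" "s \<notin> \<int>\<^sub>\<le>\<^sub>0"
  shows "continuous_on UNIV (\<lambda>y. of_real X powr (- Complex s y) * Gamma (Complex s y))"
  using assms by (intro continuous_intros continuous_on_Gamma_line continuous_on_Complex_line) auto

lemma
  assumes "X > 0"
  shows integrable_Mellin_Gamma_left_line: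
      "integrable lborel (\<lambda>y. of_real X powr (- Complex (1 / 2 - real n) y) * Gamma (Complex (1 / 2 - real n) y))"
    and norm_Mellin_Gamma_left_line_le:
      "norm (LINT y|lborel. of_real X powr (- Complex (1 / 2 - real n) y) * Gamma (Complex (1 / 2 - real n) y))
       \<le> X powr (real n - 1 / 2) / pochhammer (1 / 2) n * (LINT y|lborel. norm (Gamma (Complex (1 / 2) y)))"
proof -
  define h where "h = (\<lambda>w. of_real X powr (- w) * Gamma w :: complex)"
  define A where "A = X powr (real n - 1 / 2) / pochhammer (1 / 2) n"
  have A: "A \<ge> 0" by (auto simp: A_def intro!: divide_nonneg_nonneg pochhammer_nonneg)
  have bd: "norm (h (Complex (1 / 2 - real n) y)) \<le> A * norm (Gamma (Complex (1 / 2) y))" for y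
  proof -
    have "norm (h (Complex (1 / 2 - real n) y)) = X powr (real n - 1 / 2) * norm (Gamma (Complex (1 / 2 - real n) y))"
      using assms by (simp add: h_def norm_mult norm_of_real_powr_complex)
    also have "\<dots> \<le> X powr (real n - 1 / 2) * (norm (Gamma (Complex (1 / 2) y)) / pochhammer (1 / 2) n)"
      by (intro mult_left_mono norm_Gamma_left_line) auto
    finally show ?thesis by (simp add: A_def)
  qed
  obtain B where B: "\<And>s y. 1 / 2 \<le> s \<Longrightarrow> s \<le> 1 / 2 \<Longrightarrow> norm (Gamma (Complex s y)) powr 1 \<le> B / (1 + y\<^sup>2)"
    using norm_Gamma_strip_bound[of "1 / 2" 1 "1 / 2"] by (metis half_gt_zero zero_less_one)
  have "1 / 2 - real 0 \<notin> \<int>\<^sub>\<le>\<^sub>0" by (rule half_minus_nat_not_nonpos_Ints)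
  hence "integrable lborel (\<lambda>y. Gamma (Complex (1 / 2) y))"
    using B[of "1 / 2"] by (intro integrable_line[where B = B] continuous_on_Gamma_line) auto
  hence int': "integrable lborel (\<lambda>y. A * norm (Gamma (Complex (1 / 2) y)))"
    by (intro integrable_mult_right integrable_norm)
  have int: "integrable lborel (\<lambda>y. h (Complex (1 / 2 - real n) y))"
  proof (rule Bochner_Integration.integrable_bound[OF int'])
    show "(\<lambda>y. h (Complex (1 / 2 - real n) y)) \<in> borel_measurable lborel"
      unfolding h_def using assms
      by (auto intro!: borel_measurable_continuous_onI continuous_on_Mellin_Gamma_line half_minus_nat_not_nonpos_Ints)
    show "AE y in lborel. norm (h (Complex (1 / 2 - real n) y)) \<le> norm (A * norm (Gamma (Complex (1 / 2) y)))"
      unfolding real_norm_def by (intro AE_I2 order_trans[OF bd abs_ge_self])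
  qed
  thus "integrable lborel (\<lambda>y. of_real X powr (- Complex (1 / 2 - real n) y) * Gamma (Complex (1 / 2 - real n) y))"
    by (simp add: h_def)
  have "norm (LINT y|lborel. h (Complex (1 / 2 - real n) y)) \<le> (LINT y|lborel. A * norm (Gamma (Complex (1 / 2) y)))"
    by (rule Bochner_Integration.integral_norm_bound_integral[OF int int' bd])
  thus "norm (LINT y|lborel. of_real X powr (- Complex (1 / 2 - real n) y) * Gamma (Complex (1 / 2 - real n) y))
       \<le> X powr (real n - 1 / 2) / pochhammer (1 / 2) n * (LINT y|lborel. norm (Gamma (Complex (1 / 2) y)))"
    by (simp add: h_def A_def)
qed

text \<open>The right-hand side is the residue at \<open>-n\<close>, the only pole between the two lines.\<close>

lemma Mellin_Gamma_contour_integral: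
  assumes "X > 0" "R > 0"
  shows "((\<lambda>w. of_real X powr (- w) * Gamma w) has_contour_integral
           (of_real (2 * pi) * \<i> * ((- complex_of_real X) ^ n / fact n)))
         (rectpath (Complex (1 / 2 - real (Suc n)) (- R)) (Complex (1 / 2 - real n) R))"
proof -
  define S where "S = {w. Re w > - real n - 1} \<inter> {w. Re w < - real n + 1}"
  define p where "p = (- of_nat n :: complex)"
  \<comment> \<open>Gamma(w) = Gamma(w + n + 1) / (w (w + 1) ... (w + n)), and the last factor is w
    - p. The rest, f, is holomorphic on the open strip \<open>S\<close>: there w + n + 1 has
    positive real part, and 0, -1, ..., -(n - 1) lie outside. So Cauchy's integral formula for f at
    p gives the residue.\<close>
  define f where "f = (\<lambda>w. complex_of_real X powr (- w) * (Gamma (w + of_nat (Suc n)) / pochhammer w n))"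
  define \<gamma> where "\<gamma> = rectpath (Complex (1 / 2 - real (Suc n)) (- R)) (Complex (1 / 2 - real n) R)"
  have "open S" unfolding S_def by (intro open_Int open_halfspace_Re_gt open_halfspace_Re_lt)
  have pim: "path_image \<gamma> \<subseteq> S - {p}" "w \<notin> \<int>\<^sub>\<le>\<^sub>0" if "w \<in> path_image \<gamma>" for w
  proof -
    show "path_image \<gamma> \<subseteq> S - {p}"
      using assms by (auto simp: \<gamma>_def path_image_rectpath S_def p_def)
    show "w \<notin> \<int>\<^sub>\<le>\<^sub>0"
    proof (cases "Im w = 0")
      case True
      hence "Re w = 1 / 2 - real n \<or> Re w = 1 / 2 - real (Suc n)"
        using that assms by (auto simp: \<gamma>_def path_image_rectpath)
      hence "Complex (Re w) (Im w) \<notin> \<int>\<^sub>\<le>\<^sub>0"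
        using half_minus_nat_not_nonpos_Ints[of n] half_minus_nat_not_nonpos_Ints[of "Suc n"]
        by (metis Complex_not_nonpos_Ints)
      thus ?thesis by simp
    qed (auto elim!: nonpos_Ints_cases)
  qed
  have poch: "pochhammer w n \<noteq> 0" if "w \<in> S" for w
    using that by (auto simp: pochhammer_eq_0_iff S_def)
  have "((\<lambda>w. f w / (w - p)) has_contour_integral (of_real (2 * pi) * \<i> * winding_number \<gamma> p * f p)) \<gamma>"
  proof (rule Cauchy_integral_formula_convex_simple)
    show "convex S" unfolding S_def by (intro convex_Int convex_halfspace_Re_gt convex_halfspace_Re_lt)
    have "(\<lambda>w. pochhammer w n) holomorphic_on S"
      unfolding pochhammer_prod by (intro holomorphic_intros)
    moreover have "w + of_nat (Suc n) \<notin> \<int>\<^sub>\<le>\<^sub>0" if "w \<in> S" for w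
      using that by (intro Re_pos_not_nonpos_Ints) (auto simp: S_def)
    ultimately show "f holomorphic_on S"
      unfolding f_def using assms poch
      by (intro holomorphic_intros) auto
    show "p \<in> interior S" unfolding interior_open[OF \<open>open S\<close>] by (simp add: S_def p_def)
    show "path_image \<gamma> \<subseteq> S - {p}"
      using assms by (auto simp: \<gamma>_def path_image_rectpath S_def p_def)
  qed (auto simp: \<gamma>_def)
  moreover have "winding_number \<gamma> p = 1"
    unfolding \<gamma>_def using assms by (intro winding_number_rectpath) (auto simp: in_box_complex_iff p_def)
  moreover have "f p = (- complex_of_real X) ^ n / fact n"
  proof -
    have "pochhammer p n = (- 1) ^ n * fact n" by (simp add: p_def pochhammer_same)
    moreover have "of_real X powr (- p) = of_real X ^ n"
      using assms by (simp add: p_def powr_nat)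
    moreover have "Gamma (p + of_nat (Suc n)) = 1" by (simp add: p_def)
    moreover have "inverse ((- 1) ^ n) = ((- 1) ^ n :: complex)" by (simp flip: power_inverse)
    ultimately show ?thesis
      by (simp add: f_def divide_inverse power_minus[of "of_real X"] mult_ac)
  qed
  ultimately have "((\<lambda>w. f w / (w - p)) has_contour_integral (of_real (2 * pi) * \<i> * ((- complex_of_real X) ^ n / fact n))) \<gamma>"
    by simp
  thus ?thesis unfolding \<gamma>_def [symmetric]
  proof (rule has_contour_integral_eq)
    fix w assume w: "w \<in> path_image \<gamma>"
    have "w - p \<noteq> 0" using pim(1)[OF w] w by auto
    moreover have "pochhammer w n \<noteq> 0" using pim(1)[OF w] w by (intro poch) auto
    ultimately show "f w / (w - p) = of_real X powr (- w) * Gamma w"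
      using Gamma_eq_shifted[OF pim(2)[OF w], of "Suc n"]
      by (simp add: f_def p_def pochhammer_rec' field_simps)
  qed
qed

lemma Mellin_Gamma_step:
  assumes "X > 0"
  shows "(LINT y|lborel. of_real X powr (- Complex (1 / 2 - real n) y) * Gamma (Complex (1 / 2 - real n) y)) =
         (LINT y|lborel. of_real X powr (- Complex (1 / 2 - real (Suc n)) y) * Gamma (Complex (1 / 2 - real (Suc n)) y)) +
         complex_of_real (2 * pi) * ((- complex_of_real X) ^ n / fact n)"
proof -
  \<comment> \<open>Adding n + 1 carries the strip between the two lines onto 1/2 \<le> Re z \<le>
    3/2, where this bound holds. For \<bar>y\<bar> \<ge> 1 all the factors divided by have norm at
    least 1, so the bound carries over.\<close>
  obtain B where B: "\<And>s y. 1 / 2 \<le> s \<Longrightarrow> s \<le> 3 / 2 \<Longrightarrow> norm (Gamma (Complex s y)) powr 1 \<le> B / (1 + y\<^sup>2)"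
    using norm_Gamma_strip_bound[of "1 / 2" 1 "3 / 2"] by (metis half_gt_zero zero_less_one)
  define M where "M = X powr (- (1 / 2 - real (Suc n))) + X powr (- (1 / 2 - real n))"
  show ?thesis
  proof (rule vertical_line_integral_shift[where h = "\<lambda>w. of_real X powr (- w) * Gamma w" and B = "M * B"])
    show "norm (of_real X powr (- Complex s y) * Gamma (Complex s y)) \<le> M * B / (1 + y\<^sup>2)"
      if s: "1 / 2 - real (Suc n) \<le> s" "s \<le> 1 / 2 - real n" and y: "1 \<le> \<bar>y\<bar>" for s y
    proof -
      define z where "z = Complex s y"
      have z: "z \<notin> \<int>\<^sub>\<le>\<^sub>0" using y by (auto simp: z_def complex_eq_iff elim!: nonpos_Ints_cases)
      have "(\<Prod>i=0..<Suc n. 1) \<le> (\<Prod>i=0..<Suc n. norm (z + of_nat i))"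
      proof (intro prod_mono conjI)
        show "1 \<le> norm (z + of_nat i)" for i
          using abs_Im_le_cmod[of "z + of_nat i"] y by (simp add: z_def)
      qed auto
      hence p: "1 \<le> norm (pochhammer z (Suc n))" by (simp add: pochhammer_prod prod_norm)
      have "norm (Gamma z) = norm (Gamma (z + of_nat (Suc n))) / norm (pochhammer z (Suc n))"
        by (subst Gamma_eq_shifted[OF z, of "Suc n"]) (simp_all add: norm_divide)
      also have "\<dots> \<le> norm (Gamma (z + of_nat (Suc n))) / 1"
        using p by (intro divide_left_mono) auto
      also have "z + of_nat (Suc n) = Complex (s + real (Suc n)) y" by (simp add: z_def complex_eq_iff)
      also have "norm (Gamma \<dots>) / 1 \<le> B / (1 + y\<^sup>2)"
        using B[of "s + real (Suc n)" y] s by simp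
      finally have "X powr (- s) * norm (Gamma z) \<le> M * (B / (1 + y\<^sup>2))"
        unfolding M_def using s assms by (intro mult_mono powr_le_strip) auto
      thus ?thesis using assms by (simp add: norm_mult norm_of_real_powr_complex z_def)
    qed
    show "((\<lambda>w. of_real X powr (- w) * Gamma w) has_contour_integral (of_real (2 * pi) * \<i> * ((- complex_of_real X) ^ n / fact n)))
         (rectpath (Complex (1 / 2 - real (Suc n)) (- R)) (Complex (1 / 2 - real n) R))" if "R > 0" for R
      by (rule Mellin_Gamma_contour_integral[OF assms that])
  qed (rule integrable_Mellin_Gamma_left_line[OF assms] | simp)+
qed

lemma pochhammer_half_ge: "pochhammer (1 / 2 :: real) (Suc n) \<ge> fact n / 2"
proof (induction n)
  case (Suc n)
  have "fact (Suc n) / 2 = fact n / 2 * real (Suc n)" by simp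
  also have "\<dots> \<le> pochhammer (1 / 2) (Suc n) * (1 / 2 + real (Suc n))"
    using Suc by (intro mult_mono pochhammer_nonneg) auto
  also have "\<dots> = pochhammer (1 / 2) (Suc (Suc n))" by (subst (2) pochhammer_Suc) simp
  finally show ?case .
qed auto

text \<open>Pushing the line Re z = 1/2 to the left across the poles 0, -1, -2, ... collects the
  residues (-X)^n / n!, which form the power series of exp(-X), while the integral left over is
  O(X^n / n!).\<close>

theorem Mellin_inversion_Gamma:
  assumes "X > 0" "s > 0"
  shows "(LINT y|lborel. of_real X powr (- Complex s y) * Gamma (Complex s y)) = complex_of_real (2 * pi) * exp (- complex_of_real X)"
proof -
  define G where "G = (\<lambda>s. LINT y|lborel. of_real X powr (- Complex s y) * Gamma (Complex s y))"
  have sum: "G (1 / 2) = (\<Sum>k<n. complex_of_real (2 * pi) * ((- complex_of_real X) ^ k / fact k)) + G (1 / 2 - real n)" for n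
  proof (induction n)
    case (Suc n)
    thus ?case using Mellin_Gamma_step[OF assms(1), of n] by (simp add: G_def)
  qed simp
  define J where "J = (LINT y|lborel. norm (Gamma (Complex (1 / 2) y)))"
  have J: "J \<ge> 0" unfolding J_def by (intro Bochner_Integration.integral_nonneg) auto
  have rem: "(\<lambda>n. G (1 / 2 - real (Suc n))) \<longlonglongrightarrow> 0"
  proof (rule Lim_null_comparison)
    have "norm (G (1 / 2 - real (Suc n))) \<le> 2 * X powr (1 / 2) * J * (X ^ n / fact n)" for n
    proof -
      have "norm (G (1 / 2 - real (Suc n))) \<le> X powr (real (Suc n) - 1 / 2) / pochhammer (1 / 2) (Suc n) * J"
        unfolding G_def J_def by (rule norm_Mellin_Gamma_left_line_le[OF assms(1)])
      also have "\<dots> \<le> X powr (real (Suc n) - 1 / 2) / (fact n / 2) * J"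
        using J by (intro mult_right_mono divide_left_mono pochhammer_half_ge mult_pos_pos pochhammer_pos) auto
      also have "X powr (real (Suc n) - 1 / 2) = X powr (1 / 2) * X ^ n"
        using assms by (simp add: powr_add [symmetric] powr_realpow [symmetric])
      finally show ?thesis by (simp add: field_simps)
    qed
    thus "\<forall>\<^sub>F n in sequentially. norm (G (1 / 2 - real (Suc n))) \<le> 2 * X powr (1 / 2) * J * (X ^ n / fact n)"
      by (intro always_eventually) blast
    have "(\<lambda>n. X ^ n / fact n) \<longlonglongrightarrow> 0"
      using summable_LIMSEQ_zero[OF summable_exp[of X]] by (simp add: divide_inverse mult.commute)
    thus "(\<lambda>n. 2 * X powr (1 / 2) * J * (X ^ n / fact n)) \<longlonglongrightarrow> 0"
      by (rule tendsto_mult_right_zero)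
  qed
  have "(\<lambda>n. complex_of_real (2 * pi) * ((- complex_of_real X) ^ n / fact n)) sums (complex_of_real (2 * pi) * exp (- complex_of_real X))"
    using exp_converges[of "- complex_of_real X"]
    by (intro sums_mult) (simp add: scaleR_conv_of_real divide_inverse mult.commute)
  hence "(\<lambda>n. \<Sum>k<Suc n. complex_of_real (2 * pi) * ((- complex_of_real X) ^ k / fact k)) \<longlonglongrightarrow> complex_of_real (2 * pi) * exp (- complex_of_real X)"
    unfolding sums_def by (rule LIMSEQ_Suc)
  from tendsto_add[OF this rem] have "(\<lambda>n::nat. G (1 / 2)) \<longlonglongrightarrow> complex_of_real (2 * pi) * exp (- complex_of_real X)"
    unfolding sum[symmetric] by simp
  hence half: "G (1 / 2) = complex_of_real (2 * pi) * exp (- complex_of_real X)"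
    by (simp add: LIMSEQ_const_iff)
  \<comment> \<open>Recognising the integrand as the kernel with c = 1 lets the shift lemma carry
    the result from 1/2 to any s > 0.\<close>
  have eq: "G s' = (LINT y|lborel. Gamma_power_kernel 1 X (Complex s' y))" if "s' > 0" for s'
    unfolding G_def Gamma_power_kernel_def using that by (simp add: exp_ln_Gamma_complex)
  have "G s = G (1 / 2)"
    using eq[of s] eq[of "1 / 2"] integral_Gamma_power_kernel_shift[OF assms(1) zero_less_one assms(2), of "1 / 2"] assms
    by simp
  thus ?thesis using half by (simp add: G_def)
qed

section \<open>Asymptotics of the density\<close>

text \<open>Stirling's formula is applied to both s and w = cs + d, with Ln w = ln c + Ln s + Ln (1
  + v) and v = d / (cs). By the choice of d all terms in Ln s cancel, and the constants combine to
  the last summand on the left. The four parts of the error bound come from the two Stirling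
  remainders (4c and 8/c), from cs (Ln (1 + v) - v), and from (c/2) Ln (1 + v).\<close>

lemma Gamma_power_log_comparison:
  fixes c d :: real
  assumes "c > 0" and d: "d = (1 - c) / 2"
  assumes s: "Re s \<ge> 2" "c * Re s \<ge> 4 * \<bar>d\<bar> + 4"
  shows "norm (of_real c * ln_Gamma s - (ln_Gamma (of_real c * s + of_real d) - of_real c * s * of_real (ln c)
           + of_real (c / 2 * ln c + (c - 1) / 2 * ln (2 * pi)))) \<le> (4 * c + 8 / c + 2 * d\<^sup>2 / c + \<bar>d\<bar>) / Re s"
proof -
  define w where "w = of_real c * s + of_real d"
  define L where "L = ln (2 * pi) / 2"
  define v where "v = of_real d / (of_real c * s)"
  have rs: "Re s > 0" "norm s \<ge> Re s" "norm s > 0" using s complex_Re_le_cmod[of s] by linarith+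
  have s0: "s \<noteq> 0" using rs by auto
  \<comment> \<open>The hypothesis on c Re s keeps the shift by d small: Stirling's formula applies
    at w, the real part of w is at least half that of cs, and v stays below 1/4.\<close>
  have rw: "Re w \<ge> 2" "Re w \<ge> c * Re s / 2" "c * Re s > 0"
    using s assms(1) rs by (auto simp: w_def)
  have nv: "norm v = \<bar>d\<bar> / (c * norm s)" using assms(1) by (simp add: v_def norm_divide norm_mult)
  also have "\<dots> \<le> \<bar>d\<bar> / (c * Re s)"
    using rs assms(1) by (intro divide_left_mono mult_left_mono mult_pos_pos) auto
  also have "\<dots> \<le> 1 / 4" using s rw(3) by (simp add: divide_le_eq)
  finally have v4: "norm v \<le> 1 / 4" .
  have "Re (1 + v) > 0" using abs_Re_le_cmod[of v] v4 by (simp; linarith)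
  have "Ln (of_real c * (s * (1 + v))) = Ln (of_real c) + Ln (s * (1 + v))"
  proof (rule Ln_times_of_real)
    have "1 + v \<noteq> 0" using \<open>Re (1 + v) > 0\<close> by (metis less_irrefl zero_complex.sel(1))
    thus "s * (1 + v) \<noteq> 0" using s0 by simp
  qed (use assms(1) in auto)
  also have "Ln (s * (1 + v)) = Ln s + Ln (1 + v)"
    using rs \<open>Re (1 + v) > 0\<close> by (intro Ln_mult_1_plus)
  also have "of_real c * (s * (1 + v)) = w"
    using assms(1) s0 by (simp add: w_def v_def field_simps)
  finally have lnw: "Ln w = of_real (ln c) + Ln s + Ln (1 + v)"
    using assms(1) by (simp add: Ln_of_real)
  define e where "e = Ln (1 + v) - v"
  have "c * norm s * norm e \<le> c * norm s * (2 * (norm v)\<^sup>2)"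
  proof (intro mult_left_mono)
    have "norm e \<le> (norm v)\<^sup>2 / (1 - norm v)"
      unfolding e_def using v4 by (intro Ln_approx_linear) auto
    also have "\<dots> \<le> (norm v)\<^sup>2 / (1 / 2)"
      using v4 by (intro divide_left_mono mult_pos_pos) auto
    finally show "norm e \<le> 2 * (norm v)\<^sup>2" by simp
  qed (use assms(1) in auto)
  also have "\<dots> = (2 * d\<^sup>2 / c) / norm s"
    using assms(1) s0 by (simp add: nv power2_eq_square field_simps)
  also have "\<dots> \<le> (2 * d\<^sup>2 / c) / Re s"
    using assms(1) rs by (intro divide_left_mono mult_pos_pos) auto
  finally have 1: "norm (of_real c * s * e) \<le> (2 * d\<^sup>2 / c) / Re s"
    using assms(1) by (simp add: norm_mult)
  have "c / 2 * norm (Ln (1 + v)) \<le> c / 2 * (2 * norm v)"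
    using v4 assms(1) by (intro mult_left_mono norm_Ln_le) auto
  also have "\<dots> = \<bar>d\<bar> / norm s" using assms(1) by (simp add: nv)
  also have "\<dots> \<le> \<bar>d\<bar> / Re s" using rs by (intro divide_left_mono mult_pos_pos) auto
  finally have 2: "norm (of_real (c / 2) * Ln (1 + v)) \<le> \<bar>d\<bar> / Re s"
    unfolding norm_mult norm_of_real using assms(1) by simp
  have "c * norm (ln_Gamma s - (stirling_main s + of_real L)) \<le> c * (4 / Re s)"
    unfolding L_def using s assms(1) by (intro mult_left_mono stirling_ln_Gamma) auto
  hence 3: "norm (of_real c * (ln_Gamma s - (stirling_main s + of_real L))) \<le> (4 * c) / Re s"
    using assms(1) by (simp add: norm_mult mult.commute)
  have "norm (ln_Gamma w - (stirling_main w + of_real L)) \<le> 4 / Re w"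
    unfolding L_def using rw by (intro stirling_ln_Gamma) auto
  also have "\<dots> \<le> 4 / (c * Re s / 2)"
    using rw by (intro divide_left_mono mult_pos_pos) auto
  also have "\<dots> = (8 / c) / Re s" by simp
  finally have 4: "norm (ln_Gamma w - (stirling_main w + of_real L)) \<le> (8 / c) / Re s" .
  have wc: "w = of_real c * s + of_real ((1 - c) / 2)" by (simp add: w_def d)
  \<comment> \<open>The leftover constant (1 - c)/2 = d is exactly the linear part cs v of cs Ln (1
    + v), so only the quadratic error e remains.\<close>
  have dv: "of_real ((1 - c) / 2) = of_real c * s * v"
    using assms(1) s0 by (simp add: v_def d)
  have "of_real c * ln_Gamma s - (ln_Gamma w - of_real c * s * of_real (ln c)
           + of_real (c / 2 * ln c + (c - 1) / 2 * ln (2 * pi))) =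
        of_real c * (ln_Gamma s - (stirling_main s + of_real L)) - (ln_Gamma w - (stirling_main w + of_real L))
        + (of_real c * stirling_main s + of_real c * of_real L - stirling_main w - of_real L
           + of_real c * s * of_real (ln c) - of_real (c / 2 * ln c + (c - 1) * L))"
    by (simp add: L_def algebra_simps)
  also have "of_real c * stirling_main s + of_real c * of_real L - stirling_main w - of_real L
           + of_real c * s * of_real (ln c) - of_real (c / 2 * ln c + (c - 1) * L) =
           of_real (c / 2) * Ln (1 + v) - of_real c * s * Ln (1 + v) + of_real ((1 - c) / 2)"
    unfolding stirling_main_def lnw unfolding wc by (simp add: field_simps)
  also have "\<dots> = of_real (c / 2) * Ln (1 + v) - of_real c * s * e"
    unfolding dv e_def by (simp add: algebra_simps)
  finally have eq: "of_real c * ln_Gamma s - (ln_Gamma w - of_real c * s * of_real (ln c)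
           + of_real (c / 2 * ln c + (c - 1) / 2 * ln (2 * pi))) =
       (of_real c * (ln_Gamma s - (stirling_main s + of_real L)) - (ln_Gamma w - (stirling_main w + of_real L)))
        + (of_real (c / 2) * Ln (1 + v) - of_real c * s * e)" .
  have "norm (of_real c * ln_Gamma s - (ln_Gamma w - of_real c * s * of_real (ln c)
           + of_real (c / 2 * ln c + (c - 1) / 2 * ln (2 * pi)))) \<le>
       norm (of_real c * (ln_Gamma s - (stirling_main s + of_real L)))
       + norm (ln_Gamma w - (stirling_main w + of_real L))
       + (norm (of_real (c / 2) * Ln (1 + v)) + norm (of_real c * s * e))"
    unfolding eq by (intro order_trans[OF norm_triangle_ineq] add_mono norm_triangle_ineq4)
  also have "\<dots> \<le> (4 * c) / Re s + (8 / c) / Re s + (\<bar>d\<bar> / Re s + (2 * d\<^sup>2 / c) / Re s)"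
    by (intro add_mono 1 2 3 4)
  finally show ?thesis by (simp add: w_def add_divide_distrib)
qed

text \<open>No power of M is lost: with \<sigma> = M + d, the factor sqrt \<sigma> cancels the
  \<sigma>^(-1/2) of Stirling's formula, and (\<sigma> / M)^\<sigma> \<le> exp(d + d^2 / M), whose
  exp(d) cancels the surplus in exp(-\<sigma>). The 2 in the constant absorbs the remainder
  4/\<sigma>.\<close>

lemma Gamma_shifted_real_bound:
  assumes "M \<ge> 1" "M + d \<ge> 2"
  shows "M powr (- (M + d)) * (sqrt (M + d) * Gamma (M + d)) \<le> exp (d\<^sup>2 + ln (2 * pi) / 2 + 2) * exp (- M)"
proof -
  define \<sigma> where "\<sigma> = M + d"
  have \<sigma>: "\<sigma> \<ge> 2" "M > 0" using assms by (auto simp: \<sigma>_def)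
  have "norm (complex_of_real (ln_Gamma \<sigma> - ((\<sigma> - 1 / 2) * ln \<sigma> - \<sigma> + ln (2 * pi) / 2))) \<le> 4 / \<sigma>"
    using stirling_ln_Gamma[of "of_real \<sigma>"] \<sigma> 
    by (simp add: stirling_main_def ln_Gamma_complex_of_real Ln_of_real)
  also have "\<dots> \<le> 2" using \<sigma> by (simp add: field_simps)
  finally have "\<bar>ln_Gamma \<sigma> - ((\<sigma> - 1 / 2) * ln \<sigma> - \<sigma> + ln (2 * pi) / 2)\<bar> \<le> 2"
    by (simp only: norm_of_real)
  hence 1: "ln_Gamma \<sigma> \<le> (\<sigma> - 1 / 2) * ln \<sigma> - \<sigma> + ln (2 * pi) / 2 + 2" by linarith
  have "ln (\<sigma> / M) \<le> \<sigma> / M - 1" using \<sigma> by (intro ln_le_minus_one) auto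
  also have "\<sigma> / M - 1 = d / M" using \<sigma> by (simp add: \<sigma>_def field_simps)
  finally have "\<sigma> * (ln \<sigma> - ln M) \<le> \<sigma> * (d / M)"
    using \<sigma> by (intro mult_left_mono) (auto simp: ln_div)
  also have "\<dots> = d + d\<^sup>2 / M" using \<sigma> by (simp add: \<sigma>_def field_simps power2_eq_square)
  also have "d\<^sup>2 / M \<le> d\<^sup>2" using assms by (simp add: divide_le_eq mult_right_mono[of 1 M "d\<^sup>2", simplified] mult.commute)
  finally have 2: "\<sigma> * ln \<sigma> - \<sigma> * ln M \<le> d + d\<^sup>2" by (simp add: algebra_simps)
  have "M powr (- \<sigma>) * (sqrt \<sigma> * Gamma \<sigma>) = exp (- \<sigma> * ln M + (ln \<sigma> / 2 + ln_Gamma \<sigma>))"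
  proof -
    have "sqrt \<sigma> = exp (ln \<sigma> / 2)" using \<sigma> by (simp add: powr_half_sqrt[symmetric] powr_def)
    thus ?thesis using \<sigma> by (simp add: powr_def Gamma_real_pos_exp exp_add [symmetric])
  qed
  also have "\<dots> \<le> exp (d\<^sup>2 + ln (2 * pi) / 2 + 2 + - M)"
    using 1 2 by (simp add: algebra_simps \<sigma>_def)
  finally show ?thesis unfolding \<sigma>_def exp_add .
qed

text \<open>The first exponential contains the difference estimated in
  \<open>Gamma_power_log_comparison\<close>. The rest is N^(-cz) c^(-cz) rewritten with cz = w - d
  as (cN)^d (cN)^(-w), which exposes a Mellin kernel for X = cN.\<close>

lemma Gamma_power_kernel_factor:
  fixes c d N y :: real
  assumes "c > 0" "N > 0" and d: "d = (1 - c) / 2" and "c * N + d > 0"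
  defines "z \<equiv> Complex N y" and "w \<equiv> Complex (c * N + d) (c * y)"
  shows "Gamma_power_kernel c (N powr c) z =
     exp (of_real c * ln_Gamma z - (ln_Gamma (of_real c * z + of_real d) - of_real c * z * of_real (ln c)
           + of_real (c / 2 * ln c + (c - 1) / 2 * ln (2 * pi)))) *
     (of_real (c powr (c / 2) * (2 * pi) powr ((c - 1) / 2) * (c * N) powr d) *
      (of_real (c * N) powr (- w) * Gamma w))"
proof -
  have w: "of_real c * z + of_real d = w" by (simp add: z_def w_def complex_eq_iff)
  have G: "Gamma w = exp (ln_Gamma w)" using assms by (subst exp_ln_Gamma_complex) (auto simp: w_def)
  have "Gamma_power_kernel c (N powr c) z = exp (- (of_real c * of_real (ln N) * z) + of_real c * ln_Gamma z)"
    using assms by (simp add: Gamma_power_kernel_def powr_def Ln_of_real exp_add [symmetric] mult_ac)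
  moreover have "of_real (c powr (c / 2) * (2 * pi) powr ((c - 1) / 2) * (c * N) powr d) =
      exp (of_real (c / 2 * ln c + (c - 1) / 2 * ln (2 * pi) + d * (ln c + ln N)) :: complex)"
  proof -
    have "c powr (c / 2) * (2 * pi) powr ((c - 1) / 2) * (c * N) powr d =
        exp (c / 2 * ln c + (c - 1) / 2 * ln (2 * pi) + d * (ln c + ln N))"
      using assms by (simp add: powr_def exp_add ln_mult_pos)
    thus ?thesis by (simp only: exp_of_real)
  qed
  moreover have "of_real (c * N) powr (- w) = exp (- (of_real c * z + of_real d) * of_real (ln c + ln N))"
    using assms by (simp add: powr_def Ln_of_real ln_mult w[symmetric] flip: of_real_mult)
  ultimately show ?thesis unfolding G unfolding w [symmetric]
    by (simp add: exp_add [symmetric] algebra_simps)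
qed

text \<open>The pointwise error is O(1/N) times |P|, where P is the replacement kernel. The integral
  of P is known exactly by Mellin inversion, and that of |P| is at most a constant multiple of it,
  so the error stays O(1/N) relative to the main term. The constants do not depend on b, because the
  line is moved to Re z = N anyway.\<close>

lemma integral_Gamma_power_kernel_asymptotics:
  assumes "c > 0"
  obtains C N0 where "N0 > 0" "C \<ge> 0"
    "\<And>N b. N \<ge> N0 \<Longrightarrow> b > 0 \<Longrightarrow>
       norm ((LINT y|lborel. Gamma_power_kernel c (N powr c) (Complex b y)) -
             of_real (2 * pi * ((2 * pi) powr ((c - 1) / 2) / sqrt c * N powr ((1 - c) / 2) * exp (- c * N))))
       \<le> C / N * (2 * pi * ((2 * pi) powr ((c - 1) / 2) / sqrt c * N powr ((1 - c) / 2) * exp (- c * N)))"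
proof -
  define d where "d = (1 - c) / 2"
  define C where "C = 4 * c + 8 / c + 2 * d\<^sup>2 / c + \<bar>d\<bar>"
  have C: "C > 0"
  proof -
    have "8 / c > 0" "2 * d\<^sup>2 / c \<ge> 0" using assms by auto
    thus ?thesis unfolding C_def using assms by linarith
  qed
  \<comment> \<open>The bounds 2 and (4|d| + 4)/c are the hypotheses of the logarithmic comparison
    at Re z = N; the bound 2C makes the exponent E at most 1/2, so that exp E - 1 is controlled
    linearly.\<close>
  define N0 where "N0 = max 2 (max (2 * C) ((4 * \<bar>d\<bar> + 4) / c))"
  obtain C1 where C1: "C1 > 0" "\<And>s. s \<ge> 1 \<Longrightarrow> integrable lborel (\<lambda>y. Gamma (Complex s y))"
    "\<And>s. s \<ge> 1 \<Longrightarrow> (LINT y|lborel. norm (Gamma (Complex s y))) \<le> C1 * sqrt s * Gamma s"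
    using integral_norm_Gamma_le by metis
  define C3 where "C3 = exp (d\<^sup>2 + ln (2 * pi) / 2 + 2)"
  define A where "A = c powr (c / 2) * (2 * pi) powr ((c - 1) / 2)"
  have "norm ((LINT y|lborel. Gamma_power_kernel c (N powr c) (Complex b y)) -
             of_real (2 * pi * ((2 * pi) powr ((c - 1) / 2) / sqrt c * N powr ((1 - c) / 2) * exp (- c * N))))
       \<le> (2 * C * C1 * C3 / (2 * pi)) / N * (2 * pi * ((2 * pi) powr ((c - 1) / 2) / sqrt c * N powr ((1 - c) / 2) * exp (- c * N)))"
    if N: "N \<ge> N0" and b: "b > 0" for N b
  proof -
    define M where "M = c * N"
    define \<sigma> where "\<sigma> = M + d"
    have N': "N \<ge> 2" "N \<ge> 2 * C" "M \<ge> 4 * \<bar>d\<bar> + 4"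
      using N assms by (auto simp: N0_def M_def field_simps)
    have \<sigma>: "\<sigma> \<ge> 2" "M \<ge> 1" "M > 0" using N' by (auto simp: \<sigma>_def)
    define P where "P = (\<lambda>y. of_real M powr (- Complex \<sigma> y) * Gamma (Complex \<sigma> y))"
    have normP: "norm (P y) = M powr (- \<sigma>) * norm (Gamma (Complex \<sigma> y))" for y
      using \<sigma> by (simp add: P_def norm_mult norm_of_real_powr_complex)
    define main where "main = 2 * pi * ((2 * pi) powr ((c - 1) / 2) / sqrt c * N powr ((1 - c) / 2) * exp (- c * N))"
    have main: "main = A * M powr d * (2 * pi * exp (- M)) / c"
    proof -
      \<comment> \<open>Together with the Jacobian 1/c from rescaling y to cy, this is the origin of
        1 / sqrt c in the final constant.\<close>
      have "c powr (c / 2) * c powr d = sqrt c"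
        using assms by (simp add: d_def powr_half_sqrt[symmetric] flip: powr_add add_divide_distrib)
      hence "c powr (c / 2) * c powr d / c = 1 / sqrt c"
        using assms real_sqrt_mult_self[of c] by (simp add: divide_simps)
      moreover have "A * M powr d * (2 * pi * exp (- M)) / c =
          (c powr (c / 2) * c powr d / c) * (2 * pi * (2 * pi) powr ((c - 1) / 2) * N powr d * exp (- c * N))"
        using assms N' by (simp add: A_def M_def powr_mult)
      ultimately show ?thesis by (simp add: main_def d_def)
    qed
    have kint: "integrable lborel (\<lambda>y. Gamma_power_kernel c (N powr c) (Complex N y))"
      using assms N' by (intro integrable_Gamma_power_kernel) auto
    have Pint: "integrable lborel P"
    proof -
      have "\<sigma> \<notin> \<int>\<^sub>\<le>\<^sub>0" using \<sigma> by (auto elim!: nonpos_Ints_cases)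
      hence m: "P \<in> borel_measurable lborel"
        using \<sigma> unfolding P_def by (auto intro!: borel_measurable_continuous_onI continuous_on_Mellin_Gamma_line)
      have "integrable lborel (\<lambda>y. M powr (- \<sigma>) * norm (Gamma (Complex \<sigma> y)))"
        using \<sigma> by (intro integrable_mult_right integrable_norm C1) auto
      thus ?thesis using m
        by (rule Bochner_Integration.integrable_bound) (auto simp: normP abs_mult)
    qed
    have Pint': "integrable lborel (\<lambda>y. P (c * y))"
      using lborel_integrable_real_affine[OF Pint, of c 0] assms by simp
    have LP: "(LINT y|lborel. P (c * y)) = of_real (2 * pi * exp (- M) / c)"
    proof -
      have "(LINT y|lborel. P y) = of_real c * (LINT y|lborel. P (c * y))"
        using lborel_integral_real_affine[of c P 0] assms by (simp add: scaleR_conv_of_real)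
      moreover have "(LINT y|lborel. P y) = of_real (2 * pi * exp (- M))"
        using Mellin_inversion_Gamma[of M \<sigma>] \<sigma> by (simp add: P_def exp_of_real[symmetric])
      ultimately show ?thesis using assms by (simp add: field_simps)
    qed
    have LnP: "(LINT y|lborel. norm (P (c * y))) \<le> C1 * C3 * exp (- M) / c"
    proof -
      have "(LINT y|lborel. norm (P y)) = c * (LINT y|lborel. norm (P (c * y)))"
        using lborel_integral_real_affine[of c "\<lambda>y. norm (P y)" 0] assms by simp
      moreover have "(LINT y|lborel. norm (P y)) \<le> C1 * C3 * exp (- M)"
      proof -
        have "(LINT y|lborel. norm (P y)) = M powr (- \<sigma>) * (LINT y|lborel. norm (Gamma (Complex \<sigma> y)))"
          by (simp add: normP)
        also have "\<dots> \<le> M powr (- \<sigma>) * (C1 * sqrt \<sigma> * Gamma \<sigma>)"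
          using \<sigma> by (intro mult_left_mono C1) auto
        also have "\<dots> = C1 * (M powr (- \<sigma>) * (sqrt \<sigma> * Gamma \<sigma>))" by simp
        also have "\<dots> \<le> C1 * (C3 * exp (- M))"
          unfolding C3_def \<sigma>_def using C1(1) \<sigma> 
          by (intro mult_left_mono Gamma_shifted_real_bound) (auto simp: \<sigma>_def)
        finally show ?thesis by simp
      qed
      ultimately show ?thesis using assms by (simp add: field_simps)
    qed
    have bd: "norm (Gamma_power_kernel c (N powr c) (Complex N y) - of_real (A * M powr d) * P (c * y)) \<le>
          (A * M powr d * (2 * C / N)) * norm (P (c * y))" for y
    proof -
      define z where "z = Complex N y"
      define E where "E = of_real c * ln_Gamma z - (ln_Gamma (of_real c * z + of_real d) - of_real c * z * of_real (ln c)
           + of_real (c / 2 * ln c + (c - 1) / 2 * ln (2 * pi)))"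
      have "norm E \<le> C / Re z"
        unfolding E_def C_def using N' assms
        by (intro Gamma_power_log_comparison) (auto simp: d_def z_def M_def)
      hence E: "norm E \<le> C / N" by (simp add: z_def)
      also have "C / N \<le> 1 / 2" using N' C by simp
      finally have "norm (exp E - 1) \<le> 3 / 2 * norm E" by (intro norm_exp_bounds) auto
      also have "\<dots> \<le> 2 * norm E" by simp
      finally have E': "norm (exp E - 1) \<le> 2 * C / N" using E by simp
      have "Gamma_power_kernel c (N powr c) (Complex N y) = exp E * (of_real (A * M powr d) * P (c * y))"
        using Gamma_power_kernel_factor[of c N d y] assms N' \<sigma>
        by (simp add: E_def z_def P_def A_def M_def \<sigma>_def d_def)
      hence "Gamma_power_kernel c (N powr c) (Complex N y) - of_real (A * M powr d) * P (c * y) =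
          (exp E - 1) * (of_real (A * M powr d) * P (c * y))" by (simp add: algebra_simps)
      hence "norm (Gamma_power_kernel c (N powr c) (Complex N y) - of_real (A * M powr d) * P (c * y)) =
          norm (exp E - 1) * (A * M powr d * norm (P (c * y)))"
        by (simp add: norm_mult A_def abs_mult)
      also have "\<dots> \<le> (2 * C / N) * (A * M powr d * norm (P (c * y)))"
        using E' by (intro mult_right_mono) (auto simp: A_def)
      finally show ?thesis by (simp add: mult_ac)
    qed
    have "(LINT y|lborel. Gamma_power_kernel c (N powr c) (Complex b y)) =
          (LINT y|lborel. Gamma_power_kernel c (N powr c) (Complex N y))"
      using assms b N' by (intro integral_Gamma_power_kernel_shift) auto
    moreover have "of_real main = (LINT y|lborel. of_real (A * M powr d) * P (c * y))"
      by (subst integral_mult_right_zero) (simp add: LP main)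
    ultimately have "norm ((LINT y|lborel. Gamma_power_kernel c (N powr c) (Complex b y)) - of_real main) =
        norm (LINT y|lborel. Gamma_power_kernel c (N powr c) (Complex N y) - of_real (A * M powr d) * P (c * y))"
      using kint Pint' by (subst Bochner_Integration.integral_diff) auto
    also have "\<dots> \<le> (LINT y|lborel. (A * M powr d * (2 * C / N)) * norm (P (c * y)))"
      using kint Pint' bd
      by (intro Bochner_Integration.integral_norm_bound_integral) (auto intro!: Bochner_Integration.integrable_diff)
    also have "\<dots> = (A * M powr d * (2 * C / N)) * (LINT y|lborel. norm (P (c * y)))"
      by (rule integral_mult_right_zero)
    also have "\<dots> \<le> (A * M powr d * (2 * C / N)) * (C1 * C3 * exp (- M) / c)"
      using C N' by (intro mult_left_mono LnP) (auto simp: A_def)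
    also have "\<dots> = (2 * C * C1 * C3 / (2 * pi)) / N * main"
      unfolding main by simp
    finally show ?thesis unfolding main_def .
  qed
  moreover have "N0 > 0" by (simp add: N0_def)
  moreover have "2 * C * C1 * C3 / (2 * pi) \<ge> 0" using C C1 by (simp add: C3_def)
  ultimately show thesis using that by blast
qed

text \<open>The substitution x = -y/a turns the argument of Gamma into b + iy, and t^(ix - 1)
  becomes t^(b/a - 1) (t^(1/a))^(-(b + iy)); the power of t in front compensates for the real part
  b.\<close>

lemma e_density_eq:
  assumes "a > 0" "b > 0" "t > 0"
  shows "e_density c a b t = of_real (t powr (b / a - 1) / (2 * pi * a * Gamma b powr c)) *
           (LINT y|lborel. Gamma_power_kernel c (t powr (1 / a)) (Complex b y))"
proof -
  define f where "f = (\<lambda>x. of_real t powr (\<i> * of_real x - 1) *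
        Gamma_ratio_power c b (of_real b - \<i> * of_real a * of_real x))"
  have eq: "f ((-1 / a) * y) = of_real (t powr (b / a - 1) * Gamma b powr (- c)) *
              Gamma_power_kernel c (t powr (1 / a)) (Complex b y)" for y
  proof -
    have arg: "of_real b - \<i> * of_real a * of_real ((-1 / a) * y) = Complex b y"
      using assms by (simp add: complex_eq_iff)
    have "(\<i> * of_real ((-1 / a) * y) - 1) * of_real (ln t) =
          of_real ((b / a - 1) * ln t) - Complex b y * of_real (1 / a * ln t)"
      using assms(1) by (simp add: complex_eq_iff field_simps)
    hence "of_real t powr (\<i> * of_real ((-1 / a) * y) - 1) =
          exp (of_real ((b / a - 1) * ln t) - Complex b y * of_real (1 / a * ln t))"
      using assms by (simp add: powr_def Ln_of_real)
    also have "\<dots> = of_real (t powr (b / a - 1)) * of_real (t powr (1 / a)) powr (- Complex b y)"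
      using assms by (simp add: powr_def exp_diff exp_minus exp_of_real[symmetric] Ln_of_real divide_inverse mult_ac)
    finally have 1: "of_real t powr (\<i> * of_real ((-1 / a) * y) - 1) = \<dots>" .
    have "Gamma b \<noteq> 0" using Gamma_real_pos[OF assms(2)] by (rule less_imp_neq[THEN not_sym])
    hence "exp (- (of_real c * ln_Gamma (of_real b))) = complex_of_real (Gamma b powr (- c))"
      using assms by (simp add: ln_Gamma_complex_of_real ln_Gamma_real_pos powr_def exp_of_real[symmetric])
    hence 2: "Gamma_ratio_power c b (Complex b y) = of_real (Gamma b powr (- c)) * exp (of_real c * ln_Gamma (Complex b y))"
      by (simp add: Gamma_ratio_power_def exp_diff exp_minus field_simps)
    show ?thesis unfolding f_def arg 1 2 Gamma_power_kernel_def by simp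
  qed
  have "(LINT x|lborel. f x) = \<bar>-1 / a\<bar> *\<^sub>R (LINT y|lborel. f (0 + (-1 / a) * y))"
    using assms by (intro lborel_integral_real_affine) auto
  also have "(\<lambda>y. f (0 + (-1 / a) * y)) = (\<lambda>y. of_real (t powr (b / a - 1) * Gamma b powr (- c)) *
              Gamma_power_kernel c (t powr (1 / a)) (Complex b y))"
    by (simp only: eq add_0_left)
  also have "(LINT y|lborel. of_real (t powr (b / a - 1) * Gamma b powr (- c)) *
        Gamma_power_kernel c (t powr (1 / a)) (Complex b y)) =
      of_real (t powr (b / a - 1) * Gamma b powr (- c)) * (LINT y|lborel. Gamma_power_kernel c (t powr (1 / a)) (Complex b y))"
    by (rule integral_mult_right_zero)
  finally have "e_density c a b t = 1 / (2 * of_real pi) * (\<bar>-1 / a\<bar> *\<^sub>R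
      (of_real (t powr (b / a - 1) * Gamma b powr (- c)) * (LINT y|lborel. Gamma_power_kernel c (t powr (1 / a)) (Complex b y))))"
    unfolding e_density_def f_def by simp
  also have "\<dots> = of_real (1 / (2 * pi) * \<bar>-1 / a\<bar> * (t powr (b / a - 1) * Gamma b powr (- c))) *
      (LINT y|lborel. Gamma_power_kernel c (t powr (1 / a)) (Complex b y))"
    by (simp only: scaleR_conv_of_real of_real_mult of_real_divide of_real_1 of_real_numeral mult.assoc)
  also have "1 / (2 * pi) * \<bar>-1 / a\<bar> * (t powr (b / a - 1) * Gamma b powr (- c)) =
      t powr (b / a - 1) / (2 * pi * a * Gamma b powr c)"
    using assms by (simp add: powr_minus_divide)
  finally show ?thesis .
qed

theorem theorem2p1:
  fixes a b c :: real
  assumes "a > 0" and "b > 0" and "c > 0"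
  shows "\<exists>R :: real \<Rightarrow> complex.
           R \<in> O[at_top](\<lambda>t. of_real (t powr (- (1 / (a * c))))) \<and>
           (\<forall>\<^sub>F t in at_top.
              e_density c a b t =
                of_real ((2 * pi) powr ((c - 1) / 2) / (a * sqrt c * Gamma b powr c) *
                  (exp (- c * t powr (1 / (a * c))) /
                     t powr (1 - (b - 1 / 2 + 1 / (2 * c)) / a))) *
                (1 + R t))"
proof -
  define main where "main = (\<lambda>t. (2 * pi) powr ((c - 1) / 2) / (a * sqrt c * Gamma b powr c) *
                  (exp (- c * t powr (1 / (a * c))) / t powr (1 - (b - 1 / 2 + 1 / (2 * c)) / a)))"
  \<comment> \<open>Taken as the exact relative error, R satisfies the claimed identity wherever the
    main term is nonzero; all the content lies in its bound.\<close>
  define R where "R = (\<lambda>t. e_density c a b t / of_real (main t) - 1)"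
  obtain C N0 where N0: "N0 > 0" "C \<ge> 0" and bound: "\<And>N b. N \<ge> N0 \<Longrightarrow> b > 0 \<Longrightarrow>
       norm ((LINT y|lborel. Gamma_power_kernel c (N powr c) (Complex b y)) -
             of_real (2 * pi * ((2 * pi) powr ((c - 1) / 2) / sqrt c * N powr ((1 - c) / 2) * exp (- c * N))))
       \<le> C / N * (2 * pi * ((2 * pi) powr ((c - 1) / 2) / sqrt c * N powr ((1 - c) / 2) * exp (- c * N)))"
    using integral_Gamma_power_kernel_asymptotics[OF assms(3)] by metis
  have Gb: "Gamma b powr c > 0"
    using Gamma_real_pos[OF assms(2)] unfolding powr_gt_zero by (rule less_imp_neq[THEN not_sym])
  have main_pos: "main t > 0" if "t > 0" for t
    unfolding main_def using that assms Gb by (intro mult_pos_pos divide_pos_pos) auto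
  have "\<forall>\<^sub>F t in at_top. norm (R t) \<le> C * norm (complex_of_real (t powr (- (1 / (a * c)))))"
    using eventually_ge_at_top[of "N0 powr (a * c)"] eventually_gt_at_top[of 0]
  proof eventually_elim
    case (elim t)
    \<comment> \<open>This choice makes N^c = t^(1/a), the parameter of the kernel, and turns the
      relative error C/N into C t^(-1/(ac)).\<close>
    define N where "N = t powr (1 / (a * c))"
    have "N0 = (N0 powr (a * c)) powr (1 / (a * c))" using N0 assms by (simp add: powr_powr)
    also have "\<dots> \<le> N" unfolding N_def using elim assms N0 by (intro powr_mono2) auto
    finally have N: "N \<ge> N0" "N > 0" using N0 by auto
    define pre where "pre = t powr (b / a - 1) / (2 * pi * a * Gamma b powr c)"
    have pre: "pre > 0" unfolding pre_def using elim assms Gb by (intro mult_pos_pos divide_pos_pos) auto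
    define K where "K = 2 * pi * ((2 * pi) powr ((c - 1) / 2) / sqrt c * N powr ((1 - c) / 2) * exp (- c * N))"
    have K: "K > 0" using assms N by (simp add: K_def)
    have Nc: "N powr c = t powr (1 / a)" using assms by (simp add: N_def powr_powr)
    \<comment> \<open>The exponent contributed by N is (1 - c)/(2ac) = (1/(2c) - 1/2)/a, which
      accounts for the -1/2 + 1/(2c) beside b in the final power of t.\<close>
    have "t powr (b / a - 1) * N powr ((1 - c) / 2) = t powr (- (1 - (b - 1 / 2 + 1 / (2 * c)) / a))"
      unfolding N_def powr_powr powr_add[symmetric]
      using assms by (intro arg_cong[of _ _ "\<lambda>x. t powr x"]) (simp add: field_simps)
    also have "\<dots> = 1 / t powr (1 - (b - 1 / 2 + 1 / (2 * c)) / a)"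
      by (rule powr_minus_divide)
    finally have tp: "t powr (b / a - 1) * N powr ((1 - c) / 2) = \<dots>" .
    have mainK: "main t = pre * K"
    proof -
      have "pre * K = (t powr (b / a - 1) * N powr ((1 - c) / 2)) *
          ((2 * pi) powr ((c - 1) / 2) / (a * sqrt c * Gamma b powr c) * exp (- c * N))"
        by (simp add: pre_def K_def mult_ac)
      thus ?thesis unfolding tp by (simp add: main_def N_def)
    qed
    define I where "I = (LINT y|lborel. Gamma_power_kernel c (N powr c) (Complex b y))"
    have "e_density c a b t = of_real pre * I"
      using e_density_eq[OF assms(1,2) elim(2), of c] by (simp add: pre_def I_def Nc)
    hence "R t = (I - of_real K) / of_real K"
      using pre K by (simp add: R_def mainK field_simps)
    hence "norm (R t) = norm (I - of_real K) / K"
      using K by (simp add: norm_divide)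
    also have "\<dots> \<le> (C / N * K) / K"
      using K bound[OF N(1) assms(2)] by (intro divide_right_mono) (auto simp: I_def K_def)
    also have "\<dots> = C * t powr (- (1 / (a * c)))"
      using K by (simp add: N_def powr_minus_divide)
    finally show ?case by simp
  qed
  hence "R \<in> O[at_top](\<lambda>t. of_real (t powr (- (1 / (a * c)))))"
    by (rule bigoI)
  moreover have "\<forall>\<^sub>F t in at_top. e_density c a b t = of_real (main t) * (1 + R t)"
    using eventually_gt_at_top[of 0]
  proof eventually_elim
    case (elim t)
    thus ?case using main_pos[OF elim] by (simp add: R_def)
  qed
  ultimately show ?thesis unfolding main_def by blast
qed

end
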